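(* For every integer $N\ge 3$, $$h_{N^2}=\begin{cases}\frac{(N-1)^2}{3}-1 & \text{if } N\equiv 1 \pmod 3,\\[4pt] \frac{N(N-2)}{3} & \text{if } N=2^l+1 \text{ for some integer } l\ge 1,\\[4pt] \frac{N(N-2)}{3}-1 & \text{otherwise,}\end{cases}$$ and $$h_{N(N+1)}=\begin{cases}\frac{N(N-1)}{3}-1 & \text{if } N\equiv 0 \text{ or } 1 \pmod 3,\\[4pt] \frac{(N+1)(N-2)}{3}-1 & \text{if } N\equiv 2 \pmod 3.\end{cases}$$
   Context: A polyomino is a finite union of closed unit squares (tiles) of the square lattice, any two meeting (if at all) in a whole edge, whose interior is connected. Its holes are the bounded connected components of its complement in the plane. For a positive integer $N$ and $\alpha\in\{N^2, N(N+1)\}$, $h_\alpha$ denotes the maximum number of holes of a polyomino contained in the $N\times N$ square (if $\alpha=N^2$), respectively in the $N\times(N+1)$ rectangle (if $\alpha=N(N+1)$). *)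

theory Defs
  imports "HOL-Analysis.Analysis"
begin

definition tile :: "int \<times> int \<Rightarrow> (real \<times> real) set" where
  "tile c = {real_of_int (fst c) .. real_of_int (fst c) + 1} \<times> {real_of_int (snd c) .. real_of_int (snd c) + 1}"

definition polyomino :: "(real \<times> real) set \<Rightarrow> bool" where
  "polyomino P \<longleftrightarrow> (\<exists>T. finite T \<and> T \<noteq> {} \<and> P = \<Union>(tile ` T)) \<and> connected (interior P)"

definition num_holes :: "(real \<times> real) set \<Rightarrow> nat" where
  "num_holes P = card {C \<in> components (- P). bounded C}"

definition hmax :: "nat \<Rightarrow> nat \<Rightarrow> nat" where
  "hmax N M = Max {num_holes P | P. polyomino P \<and> P \<subseteq> {0 .. real N} \<times> {0 .. real M}}"

end

(*
  Record the holes of a polyomino by one cell each: a set H of pairwise non-adjacent interior cells of the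
  n x m grid whose complement is connected; conversely every such H gives a polyomino with at least card H
  holes. So one minimises the defect c = (n-1)(m-1) - 3 card H, which is the number of edges outside a
  spanning tree of the adjacency graph on the other cells.

  Call two of the (n-1)(m-1) squares of four cells equivalent if they are linked through common holes. By
  duality with the spanning tree there are at most 2^c unions of equivalence classes. Hence c > 0. If c = 1
  there is a single class, all holes have the same colour in the chessboard colouring, all cells with two odd
  coordinates are holes, and the remaining holes are a half-scale copy of a configuration with c = 1; this
  forces n = m = 2^l + 1. If c = 2 and m = n + 1, the four corners contradict the chessboard colouring.
  Together with c = (n-1)(m-1) mod 3 this gives the upper bounds. For the lower bounds, small configurations
  are extended by three rows at a time with c unchanged, and halving is reversed when n = 2^l + 1.
*)

theory Submission
  imports Defs
begin

section \<open>Configurations of holes and cuts\<close>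

text \<open>A square of four cells amounts to a lattice point inside the rectangle, and the common
  side of two adjacent cells joins two lattice points. A union of classes colours these points,
  constantly around every hole; the sides of a cell form a closed walk, so the colour changes on an
  even number of them. This parity lets the changes across tree edges be computed from the leaves
  upward, which is the duality in question. For c = 1 or 2 there is room for 2 or 4 unions, and the
  empty and the full one already take two of these places; so every explicit union is informative.
  Two kinds are tested: a single square without a hole, and the set of squares containing a hole of
  even coordinate sum. The lower bounds turn on a shortage. Three more rows enlarge the product by
  3(m-1), so m-1 new holes are needed, but a zigzag through two new rows has only m-2. The missing
  one goes into the former border row beside a corner, so a cell next to it must have been kept
  free; an even row length allows this to be repeated.\<close>

type_synonym cell = "int \<times> int"

definition nbr :: "cell \<Rightarrow> cell \<Rightarrow> bool" where
  "nbr x y \<longleftrightarrow> \<bar>fst x - fst y\<bar> + \<bar>snd x - snd y\<bar> = 1"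

definition step :: "cell set \<Rightarrow> cell \<Rightarrow> cell \<Rightarrow> bool" where
  "step T x y \<longleftrightarrow> nbr x y \<and> x \<in> T \<and> y \<in> T"

abbreviation linked :: "cell set \<Rightarrow> cell \<Rightarrow> cell \<Rightarrow> bool" where
  "linked T \<equiv> (step T)\<^sup>*\<^sup>*"

definition grid :: "int \<Rightarrow> int \<Rightarrow> cell set" where
  "grid n m = {0..<n} \<times> {0..<m}"

text \<open>Holes keep off the border, so the corner \<open>(0,0)\<close> is never one and can serve
  as root.\<close>

definition valid :: "int \<Rightarrow> int \<Rightarrow> cell set \<Rightarrow> bool" where
  "valid n m H \<longleftrightarrow> H \<subseteq> {1..n-2} \<times> {1..m-2} \<and> (\<forall>x\<in>H. \<forall>y\<in>H. \<not> nbr x y)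
     \<and> (\<forall>x\<in>grid n m - H. linked (grid n m - H) (0,0) x)"

text \<open>The cycle rank of the full grid is \<open>(n-1)(m-1)\<close>; a hole removes one vertex
  and four edges, hence lowers the rank by 3.\<close>

definition defect :: "int \<Rightarrow> int \<Rightarrow> cell set \<Rightarrow> int" where
  "defect n m H = (n - 1) * (m - 1) - 3 * int (card H)"

lemma nbr_sym: "nbr x y \<longleftrightarrow> nbr y x"
  by (auto simp: nbr_def)

lemma nbr_cases:
  assumes "nbr (i,j) y"
  obtains "y = (i+1,j)" | "y = (i-1,j)" | "y = (i,j+1)" | "y = (i,j-1)"
proof -
  obtain a b where y: "y = (a,b)" by (cases y)
  have "\<bar>i - a\<bar> + \<bar>j - b\<bar> = 1" using assms by (simp add: nbr_def y)
  hence "a = i+1 \<and> b = j \<or> a = i-1 \<and> b = j \<or> a = i \<and> b = j+1 \<or> a = i \<and> b = j-1" by linarith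
  thus thesis using that y by blast
qed

lemma nbr_simps [simp]:
  "nbr (i,j) (i+1,j)" "nbr (i,j) (i-1,j)" "nbr (i,j) (i,j+1)" "nbr (i,j) (i,j-1)"
  by (auto simp: nbr_def)

lemma linked_sym: "linked T x y \<Longrightarrow> linked T y x"
proof (induction rule: rtranclp_induct)
  case (step y z)
  have "step T z y" using step(2) by (auto simp: step_def nbr_sym)
  thus ?case using step(3) by (meson converse_rtranclp_into_rtranclp)
qed simp

lemma linked_step: "linked T x y \<Longrightarrow> y \<in> T \<Longrightarrow> z \<in> T \<Longrightarrow> nbr y z \<Longrightarrow> linked T x z"
  by (meson rtranclp.rtrancl_into_rtrancl step_def)

lemma linked_mono: "linked S x y \<Longrightarrow> S \<subseteq> T \<Longrightarrow> linked T x y"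
  by (erule rtranclp_mono[THEN predicate2D, rotated]) (auto simp: step_def)

lemma finite_grid [simp]: "finite (grid n m)"
  by (simp add: grid_def)

lemma valid_finite: "valid n m H \<Longrightarrow> finite H"
  unfolding valid_def by (auto intro: finite_subset)

lemma valid_subset_grid: "valid n m H \<Longrightarrow> H \<subseteq> grid n m"
  by (auto simp: valid_def grid_def)

lemma valid_not_nbr:
  assumes "valid n m H" "(i,j) \<in> H"
  shows "(i+1,j) \<notin> H" "(i-1,j) \<notin> H" "(i,j+1) \<notin> H" "(i,j-1) \<notin> H"
  using assms nbr_simps unfolding valid_def by blast+

lemma valid_interior:
  assumes "valid n m H" "(i,j) \<in> H"
  shows "1 \<le> i" "i \<le> n - 2" "1 \<le> j" "j \<le> m - 2"
  using assms unfolding valid_def by auto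

text \<open>A breadth-first tree: \<open>d\<close> is the distance from \<open>s\<close> and
  \<open>p\<close> the last step of a shortest path. The strict decrease of \<open>d\<close> makes
  parent edges distinct and later supports induction from the leaves.\<close>

lemma linked_parent:
  fixes T :: "cell set"
  shows "\<exists>(d::cell \<Rightarrow> nat) p. \<forall>x. linked T s x \<and> x \<noteq> s \<longrightarrow> step T (p x) x \<and> d (p x) < d x"
proof -
  define d where "d x = (LEAST k. (step T ^^ k) s x)" for x
  have "\<exists>y. step T y x \<and> d y < d x" if l: "linked T s x" and ne: "x \<noteq> s" for x
  proof -
    have "\<exists>k. (step T ^^ k) s x" using l by (meson rtranclp_imp_relpowp)
    hence dx: "(step T ^^ d x) s x" unfolding d_def by (rule LeastI_ex)
    obtain k where k: "d x = Suc k" using dx ne by (cases "d x") auto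
    then obtain y where y: "(step T ^^ k) s y" "step T y x" using dx by (auto elim: relpowp_Suc_E)
    have "d y \<le> k" unfolding d_def using y(1) by (rule Least_le)
    thus ?thesis using y k by (intro exI[of _ y]) simp
  qed
  hence "\<forall>x. \<exists>y. linked T s x \<and> x \<noteq> s \<longrightarrow> step T y x \<and> d y < d x" by blast
  thus ?thesis by metis
qed

text \<open>The adjacency of the cells \<open>x\<close> and \<open>x + (1,0)\<close> is coded as \<open>(x, True)\<close>, that of \<open>x\<close> and \<open>x + (0,1)\<close>
  as \<open>(x, False)\<close>.\<close>

fun edge :: "cell \<Rightarrow> cell \<Rightarrow> cell \<times> bool" where
  "edge (i,j) (a,b) = ((min i a, min j b), i \<noteq> a)"

definition tedges :: "cell set \<Rightarrow> (cell \<times> bool) set" where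
  "tedges T = {e. \<exists>x y. step T x y \<and> e = edge x y}"

lemma edge_eqD:
  assumes "nbr x y" "nbr x' y'" "edge x y = edge x' y'"
  shows "x = x' \<and> y = y' \<or> x = y' \<and> y = x'"
  using assms by (cases x; cases y; cases x'; cases y') (auto simp: nbr_def min_def split: if_splits)

lemma edge_commute: "edge x y = edge y x"
  by (cases x; cases y) auto

lemma tedges_eq:
  "tedges T = (\<lambda>x. (x,True)) ` {(i,j). (i,j) \<in> T \<and> (i+1,j) \<in> T}
     \<union> (\<lambda>x. (x,False)) ` {(i,j). (i,j) \<in> T \<and> (i,j+1) \<in> T}" (is "_ = ?R")
proof
  show "tedges T \<subseteq> ?R"
  proof
    fix e assume "e \<in> tedges T"
    then obtain i j y where s: "(i,j) \<in> T" "y \<in> T" "nbr (i,j) y" "e = edge (i,j) y"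
      by (auto simp: tedges_def step_def)
    from s(3) show "e \<in> ?R" using s by (cases rule: nbr_cases) auto
  qed
  have "\<exists>x y. step T x y \<and> ((i,j),True) = edge x y" if "(i,j) \<in> T" "(i+1,j) \<in> T" for i j
    using that by (intro exI[of _ "(i,j)"] exI[of _ "(i+1,j)"]) (auto simp: step_def)
  moreover have "\<exists>x y. step T x y \<and> ((i,j),False) = edge x y" if "(i,j) \<in> T" "(i,j+1) \<in> T" for i j
    using that by (intro exI[of _ "(i,j)"] exI[of _ "(i,j+1)"]) (auto simp: step_def)
  ultimately show "?R \<subseteq> tedges T" by (auto simp: tedges_def)
qed

text \<open>Holes are interior, so each lies on four edges of the full grid, and non-adjacent, so no
  edge is lost twice; per direction this means two lost edges per hole.\<close>

lemma card_tedges: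
  assumes v: "valid n m H" and n: "n \<ge> 1" "m \<ge> 1"
  shows "finite (tedges (grid n m - H))"
    and "int (card (tedges (grid n m - H))) = (n-1)*m + n*(m-1) - 4 * int (card H)"
proof -
  let ?T = "grid n m - H"
  let ?A = "{(i,j). (i,j) \<in> ?T \<and> (i+1,j) \<in> ?T}" and ?B = "{(i,j). (i,j) \<in> ?T \<and> (i,j+1) \<in> ?T}"
  note fH = valid_finite[OF v]
  let ?l = "\<lambda>(i,j). (i-1,j) :: cell" and ?d = "\<lambda>(i,j). (i,j-1) :: cell"
  have A: "?A = {0..<n-1} \<times> {0..<m} - (H \<union> ?l ` H)"
    by (auto simp: grid_def image_iff case_prod_beta dest: valid_interior[OF v]) force+
  have B: "?B = {0..<n} \<times> {0..<m-1} - (H \<union> ?d ` H)"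
    by (auto simp: grid_def image_iff case_prod_beta dest: valid_interior[OF v]) force+
  have sub: "H \<union> ?l ` H \<subseteq> {0..<n-1} \<times> {0..<m}" "H \<union> ?d ` H \<subseteq> {0..<n} \<times> {0..<m-1}"
    using valid_interior[OF v] by fastforce+
  have disj: "H \<inter> ?l ` H = {}" "H \<inter> ?d ` H = {}" using valid_not_nbr[OF v] by auto
  have inj: "inj_on ?l H" "inj_on ?d H" by (auto simp: inj_on_def)
  have cu: "card (H \<union> ?l ` H) = 2 * card H" "card (H \<union> ?d ` H) = 2 * card H"
    using fH disj inj by (simp_all add: card_Un_disjoint card_image)
  have ge: "2 * card H \<le> card ({0..<n-1} \<times> {0..<m})" "2 * card H \<le> card ({0..<n} \<times> {0..<m-1})"
    using card_mono[OF _ sub(1)] card_mono[OF _ sub(2)] cu by auto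
  have cA: "int (card ?A) = (n-1)*m - 2 * int (card H)"
    unfolding A using fH sub cu ge n
    by (subst card_Diff_subset) (auto simp: card_cartesian_product of_nat_diff)
  have cB: "int (card ?B) = n*(m-1) - 2 * int (card H)"
    unfolding B using fH sub cu ge n
    by (subst card_Diff_subset) (auto simp: card_cartesian_product of_nat_diff)
  have fin: "finite ?A" "finite ?B" unfolding A B by auto
  show "finite (tedges ?T)" unfolding tedges_eq using fin by blast
  have "card (tedges ?T) = card ?A + card ?B" unfolding tedges_eq
    by (subst card_Un_disjoint) (use fin in \<open>auto simp: card_image inj_on_def\<close>)
  thus "int (card (tedges ?T)) = (n-1)*m + n*(m-1) - 4 * int (card H)"
    using cA cB by simp
qed

section \<open>Cuts and their separations along a spanning tree\<close>

definition blocks :: "int \<Rightarrow> int \<Rightarrow> cell set" where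
  "blocks n m = {0..<n-1} \<times> {0..<m-1}"

text \<open>The cell \<open>(i,j)\<close> of \<open>blocks n m\<close> stands for the square of the four cells \<open>{i,i+1} \<times> {j,j+1}\<close>.
  Members of \<open>cuts\<close> are the sets of such squares that do not separate the four squares around a hole;
  \<open>same Z e\<close> says that the two squares containing both ends of \<open>e\<close> are not separated by \<open>Z\<close>.\<close>

definition cuts :: "int \<Rightarrow> int \<Rightarrow> cell set \<Rightarrow> cell set set" where
  "cuts n m H = {Z. Z \<subseteq> blocks n m \<and> (\<forall>(i,j)\<in>H. ((i-1,j) \<in> Z \<longleftrightarrow> (i,j) \<in> Z)
     \<and> ((i,j-1) \<in> Z \<longleftrightarrow> (i,j) \<in> Z) \<and> ((i-1,j-1) \<in> Z \<longleftrightarrow> (i,j) \<in> Z))}"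

fun same :: "cell set \<Rightarrow> cell \<times> bool \<Rightarrow> bool" where
  "same Z ((i,j),True) \<longleftrightarrow> ((i,j-1) \<in> Z \<longleftrightarrow> (i,j) \<in> Z)"
| "same Z ((i,j),False) \<longleftrightarrow> ((i-1,j) \<in> Z \<longleftrightarrow> (i,j) \<in> Z)"

lemma same_edges:
  "same Z (edge (i,j) (i+1,j)) \<longleftrightarrow> ((i,j-1) \<in> Z \<longleftrightarrow> (i,j) \<in> Z)"
  "same Z (edge (i,j) (i-1,j)) \<longleftrightarrow> ((i-1,j-1) \<in> Z \<longleftrightarrow> (i-1,j) \<in> Z)"
  "same Z (edge (i,j) (i,j+1)) \<longleftrightarrow> ((i-1,j) \<in> Z \<longleftrightarrow> (i,j) \<in> Z)"
  "same Z (edge (i,j) (i,j-1)) \<longleftrightarrow> ((i-1,j-1) \<in> Z \<longleftrightarrow> (i,j-1) \<in> Z)"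
  by simp_all

text \<open>Going around a cell crosses its four edges, so a set of squares cannot separate at exactly one of them.\<close>

lemma same_fourth:
  assumes "nbr x y" "\<And>z. nbr x z \<Longrightarrow> z \<noteq> y \<Longrightarrow> same Z (edge x z)"
  shows "same Z (edge x y)"
proof (cases x)
  case (Pair i j)
  have a: "y \<noteq> (i+1,j) \<Longrightarrow> same Z (edge (i,j) (i+1,j))" "y \<noteq> (i-1,j) \<Longrightarrow> same Z (edge (i,j) (i-1,j))"
    "y \<noteq> (i,j+1) \<Longrightarrow> same Z (edge (i,j) (i,j+1))" "y \<noteq> (i,j-1) \<Longrightarrow> same Z (edge (i,j) (i,j-1))"
    using assms(2) nbr_simps unfolding Pair by blast+
  from assms(1)[unfolded Pair] show ?thesis unfolding Pair
    by (cases rule: nbr_cases) (use a in \<open>simp_all only: same_edges, auto\<close>)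
qed

text \<open>Induction along the first coordinate, starting at \<open>-1\<close>, where no element of
  \<open>blocks n m\<close> lies.\<close>

lemma same_everywhere_empty:
  assumes Z: "Z \<subseteq> blocks n m" and s: "\<And>i j. same Z ((i,j),False)"
  shows "Z = {}"
proof -
  have "(int k - 1, j) \<notin> Z" for k j
  proof (induction k)
    case 0 thus ?case using Z by (auto simp: blocks_def)
  next
    case (Suc k) thus ?case using s[of "int k" j] by (simp add: algebra_simps)
  qed
  hence "(i,j) \<notin> Z" if "i \<ge> 0" for i j using that
    by (metis add_diff_cancel_right' nat_0_le le_add_same_cancel2 add.commute add_nonneg_nonneg zero_le_one)
  thus ?thesis using Z by (force simp: blocks_def)
qed

text \<open>A cut is determined by its separations outside a spanning tree of the cells that are not holes.\<close>

lemma card_cuts: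
  assumes v: "valid n m H" and n: "n \<ge> 1" "m \<ge> 1"
  shows "0 \<le> defect n m H" "card (cuts n m H) \<le> 2 ^ nat (defect n m H)"
proof -
  define T where "T = grid n m - H"
  obtain d :: "cell \<Rightarrow> nat" and p where
    dp: "\<And>x. linked T (0,0) x \<Longrightarrow> x \<noteq> (0,0) \<Longrightarrow> step T (p x) x \<and> d (p x) < d x"
    using linked_parent[of T "(0,0)"] by blast
  have lk: "linked T (0,0) x" if "x \<in> T" for x using v that unfolding valid_def T_def by blast
  have par: "p x \<in> T" "nbr x (p x)" "d (p x) < d x" if "x \<in> T" "x \<noteq> (0,0)" for x
    using dp[OF lk that(2)] that nbr_sym by (auto simp: step_def)
  have "(0,0) \<notin> H" using valid_interior[OF v] by force
  hence z: "(0,0) \<in> T" using n by (auto simp: T_def grid_def)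
  have fT: "finite T" by (simp add: T_def)
  define P where "P = (\<lambda>x. edge x (p x)) ` (T - {(0,0)})"
  define U where "U = tedges T - P"
  have inj: "inj_on (\<lambda>x. edge x (p x)) (T - {(0,0)})"
  proof (rule inj_onI)
    fix x y assume x: "x \<in> T - {(0,0)}" and y: "y \<in> T - {(0,0)}" and e: "edge x (p x) = edge y (p y)"
    have "x = y \<and> p x = p y \<or> x = p y \<and> p x = y"
      using edge_eqD[OF _ _ e] par(2) x y by blast
    thus "x = y" using par(3)[of x] par(3)[of y] x y by auto
  qed
  have cP: "card P = card T - 1" unfolding P_def using card_image[OF inj] z fT by simp
  have PT: "P \<subseteq> tedges T" unfolding P_def tedges_def step_def using par by blast
  note ct = card_tedges[OF v n, folded T_def]
  have fU: "finite U" using ct(1) by (simp add: U_def)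
  have cT: "int (card T) = n * m - int (card H)"
    unfolding T_def using card_mono[OF _ valid_subset_grid[OF v]] n
    by (subst card_Diff_subset[OF valid_finite[OF v] valid_subset_grid[OF v]])
       (simp add: of_nat_diff grid_def card_cartesian_product)
  have "card T \<ge> 1" using z fT by (metis One_nat_def Suc_leI card_gt_0_iff empty_iff)
  have "card U = card (tedges T) - card P" unfolding U_def
    by (rule card_Diff_subset) (use PT ct(1) finite_subset in auto)
  hence cU: "int (card U) = defect n m H"
    using ct(2) cT cP \<open>card T \<ge> 1\<close> card_mono[OF ct(1) PT]
    by (simp add: of_nat_diff defect_def algebra_simps)
  thus "0 \<le> defect n m H" by simp
  let ?f = "\<lambda>Z. {e \<in> U. \<not> same Z e}"
  have "inj_on ?f (cuts n m H)"
  proof (rule inj_onI)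
    fix Z Z' assume Z: "Z \<in> cuts n m H" and Z': "Z' \<in> cuts n m H" and eq: "?f Z = ?f Z'"
    \<comment> \<open>Separations add modulo 2 under symmetric difference, so \<open>W\<close>
      separates nowhere on \<open>U\<close>; it remains to show that \<open>W\<close> separates
      nowhere at all.\<close>
    define W where "W = (Z - Z') \<union> (Z' - Z)"
    have Wsame: "same Z e = same Z' e \<Longrightarrow> same W e" for e
      by (cases "(Z,e)" rule: same.cases) (auto simp: W_def)
    have WU: "same W e" if "e \<in> U" for e using eq that by (intro Wsame) blast
    have WB: "W \<subseteq> blocks n m" using Z Z' by (auto simp: W_def cuts_def)
    have TU: "edge x y \<in> U \<or> edge x y \<in> P" if "x \<in> T" "y \<in> T" "nbr x y" for x y
      using that unfolding U_def tedges_def step_def by blast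
    have Wcut: "same W (edge x y)" if "x \<in> H" "nbr x y" for x y
    proof (cases x)
      case (Pair i j)
      from that(2)[unfolded Pair] show ?thesis unfolding Pair
        by (cases rule: nbr_cases)
          (use Z Z' that(1) in \<open>auto simp: Pair same_edges cuts_def W_def simp del: edge.simps\<close>)
    qed
    have Wout: "same W (edge x y)" if "x \<in> grid n m" "y \<notin> grid n m" "nbr x y" for x y
    proof (cases x)
      case (Pair i j)
      from that(3)[unfolded Pair] show ?thesis unfolding Pair
        by (cases rule: nbr_cases)
          (simp_all only: same_edges, use WB that in \<open>auto simp: Pair blocks_def grid_def\<close>)
    qed
    \<comment> \<open>Induction from the leaves to the root. Apart from the parent edge, each side
      of \<open>x\<close> leads outside, to a hole, across an edge of \<open>U\<close>, or to a
      child, which has larger \<open>d\<close>; \<open>same_fourth\<close> then settles the parent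
      edge.\<close>
    have Wtree: "same W (edge x (p x))" if "x \<in> T" "x \<noteq> (0,0)" for x
      using that
    proof (induction "Max (d ` T) - d x" arbitrary: x rule: less_induct)
      case less
      show ?case
      proof (rule same_fourth)
        show "nbr x (p x)" using par less by blast
        fix y assume y: "nbr x y" "y \<noteq> p x"
        consider "y \<notin> grid n m" | "y \<in> H" | "y \<in> T" "edge x y \<in> U" | "y \<in> T" "edge x y \<in> P"
          using less y(1) TU[of x y] unfolding T_def by blast
        thus "same W (edge x y)"
        proof cases
          case 1 thus ?thesis using Wout less y by (auto simp: T_def)
        next
          case 2 thus ?thesis using Wcut[of y x] y by (simp add: edge_commute nbr_sym)
        next
          case 3 thus ?thesis using WU by simp
        next
          case 4
          then obtain w where w: "w \<in> T" "w \<noteq> (0,0)" "edge x y = edge w (p w)" by (auto simp: P_def)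
          have "x = w \<and> y = p w \<or> x = p w \<and> y = w" using edge_eqD[OF y(1) par(2)[OF w(1,2)] w(3)] .
          hence xw: "x = p w" "y = w" using y by auto
          have "d x < d w" "d w \<le> Max (d ` T)" using par(3)[OF w(1,2)] xw fT w by auto
          hence "same W (edge w (p w))" by (intro less(1)) (use w in auto)
          thus ?thesis using w by simp
        qed
      qed
    qed
    have Wall: "same W (edge x y)" if nb: "nbr x y" for x y
    proof -
      consider "x \<notin> grid n m" "y \<notin> grid n m" | "x \<in> grid n m" "y \<notin> grid n m" | "y \<in> grid n m" "x \<notin> grid n m"
        | "x \<in> H" | "y \<in> H" | "edge x y \<in> U" | "edge x y \<in> P"
        using nb TU[of x y] unfolding T_def by blast
      thus ?thesis
      proof cases
        case 1
        obtain i j where x: "x = (i,j)" by (cases x)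
        from nb[unfolded x] show ?thesis unfolding x
          by (cases rule: nbr_cases)
            (simp_all only: same_edges, use WB 1 x in \<open>auto simp: blocks_def grid_def\<close>)
      next
        case 2 thus ?thesis using Wout nb by simp
      next
        case 3 thus ?thesis using Wout[of y x] nb by (simp add: edge_commute nbr_sym)
      next
        case 4 thus ?thesis using Wcut nb by simp
      next
        case 5 thus ?thesis using Wcut[of y x] nb by (simp add: edge_commute nbr_sym)
      next
        case 6 thus ?thesis using WU by simp
      next
        case 7 thus ?thesis using Wtree unfolding P_def by force
      qed
    qed
    have "same W ((i,j),False)" for i j using Wall[of "(i,j)" "(i,j+1)"] by simp
    hence "W = {}" using same_everywhere_empty[OF WB] by blast
    thus "Z = Z'" by (auto simp: W_def)
  qed
  hence "card (cuts n m H) \<le> card (Pow U)" by (rule card_inj_on_le) (use fU in auto)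
  thus "card (cuts n m H) \<le> 2 ^ nat (defect n m H)" using cU fU by (simp add: card_Pow flip: cU)
qed

section \<open>Upper bounds\<close>

definition touched :: "cell set \<Rightarrow> cell set" where
  "touched H = {(i,j). (i,j) \<in> H \<or> (i+1,j) \<in> H \<or> (i,j+1) \<in> H \<or> (i+1,j+1) \<in> H}"

text \<open>The squares that contain a hole with even coordinate sum; which diagonal of a square is even depends
  on its corner.\<close>

definition even_touched :: "int \<Rightarrow> int \<Rightarrow> cell set \<Rightarrow> cell set" where
  "even_touched n m H = {(i,j) \<in> blocks n m. if even (i+j) then (i,j) \<in> H \<or> (i+1,j+1) \<in> H
      else (i+1,j) \<in> H \<or> (i,j+1) \<in> H}"

lemma finite_blocks [simp]: "finite (blocks n m)"
  by (simp add: blocks_def)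

lemma finite_cuts: "finite (cuts n m H)"
  by (rule finite_subset[of _ "Pow (blocks n m)"]) (auto simp: cuts_def)

lemma empty_in_cuts: "{} \<in> cuts n m H"
  by (auto simp: cuts_def)

lemma Diff_in_cuts:
  assumes v: "valid n m H" and Z: "Z \<in> cuts n m H"
  shows "blocks n m - Z \<in> cuts n m H"
  using Z valid_interior[OF v] unfolding cuts_def blocks_def by auto fastforce+

lemma blocks_in_cuts: "valid n m H \<Longrightarrow> blocks n m \<in> cuts n m H"
  using Diff_in_cuts[OF _ empty_in_cuts] by simp

text \<open>The conditions in \<open>cuts\<close> mention only squares that contain a hole.\<close>

lemma untouched_in_cuts:
  assumes "b \<in> blocks n m" "b \<notin> touched H"
  shows "{b} \<in> cuts n m H"
  using assms by (cases b) (auto simp: cuts_def touched_def)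

text \<open>Two holes in one square are diagonally opposite, hence of equal parity. So the four
  squares around an even hole all belong to the set, and those around an odd hole do not.\<close>

lemma even_touched_in_cuts:
  assumes v: "valid n m H"
  shows "even_touched n m H \<in> cuts n m H"
proof -
  have "((i-1,j) \<in> even_touched n m H \<longleftrightarrow> (i,j) \<in> even_touched n m H) \<and>
    ((i,j-1) \<in> even_touched n m H \<longleftrightarrow> (i,j) \<in> even_touched n m H) \<and>
    ((i-1,j-1) \<in> even_touched n m H \<longleftrightarrow> (i,j) \<in> even_touched n m H)" if h: "(i,j) \<in> H" for i j
  proof -
    note b = valid_interior[OF v h] and a = valid_not_nbr[OF v h]
    show ?thesis using h a b by (cases "even (i+j)") (auto simp: even_touched_def blocks_def)
  qed
  thus ?thesis by (auto simp: cuts_def) (auto simp: even_touched_def)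
qed

lemma untouched_not_even: "b \<notin> touched H \<Longrightarrow> b \<notin> even_touched n m H"
  by (auto simp: touched_def even_touched_def split: if_splits)

text \<open>The empty and the full cut are distinct, which leaves no room for the exponent 0 in
  \<open>card_cuts\<close>.\<close>

lemma defect_pos:
  assumes v: "valid n m H" and n: "n \<ge> 2" "m \<ge> 2"
  shows "defect n m H > 0"
proof (rule ccontr)
  assume "\<not> defect n m H > 0"
  hence c: "card (cuts n m H) \<le> 1" using card_cuts[OF v] n by simp
  have "(0,0) \<in> blocks n m" using n by (simp add: blocks_def)
  hence "{} \<noteq> blocks n m" by blast
  hence "card {{}, blocks n m} = 2" by simp
  moreover have "card {{}, blocks n m} \<le> card (cuts n m H)"
    by (rule card_mono[OF finite_cuts]) (use empty_in_cuts blocks_in_cuts[OF v] in auto)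
  ultimately show False using c by simp
qed

section \<open>Configurations of defect 1\<close>

lemma defect_1_cuts:
  assumes v: "valid n m H" and n: "n \<ge> 2" "m \<ge> 2" and c: "defect n m H = 1"
  shows "cuts n m H = {{}, blocks n m}"
proof -
  have c: "card (cuts n m H) \<le> 2" using card_cuts[OF v] n c by simp
  have "(0,0) \<in> blocks n m" using n by (simp add: blocks_def)
  hence "{} \<noteq> blocks n m" by blast
  hence "card {{}, blocks n m} = 2" by simp
  thus ?thesis using c empty_in_cuts blocks_in_cuts[OF v]
    by (intro card_seteq[symmetric] finite_cuts) auto
qed

text \<open>Three of the four cells of a corner square lie on the border.\<close>

lemma corner_touched:
  assumes v: "valid n m H"
  shows "(0,0) \<in> touched H \<longleftrightarrow> (1,1) \<in> H" "(n-2,0) \<in> touched H \<longleftrightarrow> (n-2,1) \<in> H"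
    "(0,m-2) \<in> touched H \<longleftrightarrow> (1,m-2) \<in> H"
proof -
  have "(0,j) \<notin> H" "(j,0) \<notin> H" "(n-1,j) \<notin> H" "(j,m-1) \<notin> H" for j
    using valid_interior[OF v, of 0 j] valid_interior[OF v, of j 0] valid_interior[OF v, of "n-1" j]
      valid_interior[OF v, of j "m-1"] by auto
  thus "(0,0) \<in> touched H \<longleftrightarrow> (1,1) \<in> H" "(n-2,0) \<in> touched H \<longleftrightarrow> (n-2,1) \<in> H"
    "(0,m-2) \<in> touched H \<longleftrightarrow> (1,m-2) \<in> H" by (simp_all add: touched_def)
qed

text \<open>The last step of a path from the root ends in \<open>x\<close>. Used to refute cells
  enclosed by four holes.\<close>

lemma valid_step:
  assumes v: "valid n m H" and x: "x \<in> grid n m - H" "x \<noteq> (0,0)"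
  shows "\<exists>y. nbr x y \<and> y \<in> grid n m - H"
proof -
  have "linked (grid n m - H) (0,0) x" using v x by (auto simp: valid_def)
  thus ?thesis using x(2) by (cases rule: rtranclp.cases) (use nbr_sym in \<open>auto simp only: step_def\<close>)
qed

text \<open>An untouched corner square would be a non-trivial cut, so \<open>(1,1)\<close> is a
  hole; it is even, so the cut \<open>even_touched\<close> is not empty and must be everything. The
  only possible hole \<open>(n-2,1)\<close> of another corner square is then even, which makes
  \<open>n\<close> odd, and likewise for \<open>m\<close>.\<close>

lemma defect_1_odd:
  assumes v: "valid n m H" and n: "n \<ge> 3" "m \<ge> 3" and c: "defect n m H = 1"
  shows "odd n" "odd m" "even_touched n m H = blocks n m"
proof -
  note cuts = defect_1_cuts[OF v _ _ c]
  have b: "(0,0) \<in> blocks n m" "(1,0) \<in> blocks n m" using n by (auto simp: blocks_def)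
  have "(0,0) \<in> touched H"
  proof (rule ccontr)
    assume "(0,0) \<notin> touched H"
    hence "{(0,0)} \<in> cuts n m H" using untouched_in_cuts b by blast
    hence "{(0,0)} = blocks n m" using cuts n by auto
    thus False using b(2) by (metis prod.inject singletonD zero_neq_one)
  qed
  hence "(1,1) \<in> H" using corner_touched[OF v] by simp
  hence "(0,0) \<in> even_touched n m H" using b by (simp add: even_touched_def)
  thus E: "even_touched n m H = blocks n m" using even_touched_in_cuts[OF v] cuts n by auto
  have nb: "(n-2,0) \<in> even_touched n m H" "(0,m-2) \<in> even_touched n m H" unfolding E using n by (auto simp: blocks_def)
  show "odd n"
  proof
    assume "even n"
    hence "(n-2,0) \<in> H \<or> (n-1,1) \<in> H" using nb(1) by (simp add: even_touched_def)
    thus False using valid_interior[OF v, of "n-2" 0] valid_interior[OF v, of "n-1" 1] by auto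
  qed
  show "odd m"
  proof
    assume "even m"
    hence "(0,m-2) \<in> H \<or> (1,m-1) \<in> H" using nb(2) by (simp add: even_touched_def)
    thus False using valid_interior[OF v, of 0 "m-2"] valid_interior[OF v, of 1 "m-1"] by auto
  qed
qed

text \<open>The odd cells that are not holes, together with their neighbours, form a set that no
  path avoiding holes can leave; as \<open>(0,0)\<close> is not in it, connectivity excludes such
  cells.\<close>

lemma defect_1_odd_cells:
  assumes v: "valid n m H" and n: "n \<ge> 3" "m \<ge> 3" and c: "defect n m H = 1"
    and ij: "odd i" "odd j" "1 \<le> i" "i \<le> n-2" "1 \<le> j" "j \<le> m-2"
  shows "(i,j) \<in> H"
proof (rule ccontr)
  note E = defect_1_odd[OF v n c]
  define X where "X = {(i,j). odd i \<and> odd j \<and> 1 \<le> i \<and> i \<le> n-2 \<and> 1 \<le> j \<and> j \<le> m-2 \<and> (i,j) \<notin> H}"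
  define Y where "Y = X \<union> {y. \<exists>x\<in>X. nbr x y}"
  \<comment> \<open>Each square around \<open>(i,j)\<close> contains an even hole. Its even cells
    are \<open>(i,j)\<close>, which is no hole, and the one diagonally opposite.\<close>
  have diag: "(i+1,j+1) \<in> H" "(i-1,j-1) \<in> H" "(i+1,j-1) \<in> H" "(i-1,j+1) \<in> H" if "(i,j) \<in> X" for i j
  proof -
    have "(i,j) \<in> blocks n m" "(i-1,j-1) \<in> blocks n m" "(i,j-1) \<in> blocks n m" "(i-1,j) \<in> blocks n m"
      using that unfolding X_def blocks_def by auto
    hence "(i,j) \<in> even_touched n m H" "(i-1,j-1) \<in> even_touched n m H" "(i,j-1) \<in> even_touched n m H"
      "(i-1,j) \<in> even_touched n m H" unfolding E by auto
    thus "(i+1,j+1) \<in> H" "(i-1,j-1) \<in> H" "(i+1,j-1) \<in> H" "(i-1,j+1) \<in> H"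
      using that by (auto simp: even_touched_def X_def)
  qed
  \<comment> \<open>The diagonal holes are interior and \<open>n\<close>, \<open>m\<close> are odd,
    so an odd cell two steps away is still interior.\<close>
  have move: "(a,b) \<in> X" if "(i,j) \<in> X" "(a,b) \<notin> H" "\<bar>a-i\<bar> + \<bar>b-j\<bar> = 2" "a = i \<or> b = j" for i j a b
  proof -
    have *: "odd i" "odd j" using that(1) by (auto simp: X_def)
    have d: "1 \<le> i-1" "i+1 \<le> n-2" "1 \<le> j-1" "j+1 \<le> m-2"
      using valid_interior[OF v diag(2)[OF that(1)]] valid_interior[OF v diag(1)[OF that(1)]] by simp_all
    have "i + 1 \<noteq> n - 2" "j + 1 \<noteq> m - 2" "i \<noteq> 2" "j \<noteq> 2" using E(1,2) * by presburger+
    hence **: "i+2 \<le> n-2" "j+2 \<le> m-2" "i \<ge> 3" "j \<ge> 3" using d by auto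
    have "a = i \<and> (b = j+2 \<or> b = j-2) \<or> b = j \<and> (a = i+2 \<or> a = i-2)" using that(3,4) by arith
    thus ?thesis using * ** that(2) by (auto simp: X_def)
  qed
  have closed: "y \<in> Y" if y: "x \<in> Y" "step (grid n m - H) x y" for x y
  proof (cases "x \<in> X")
    case True
    moreover have "nbr x y" using y(2) by (simp add: step_def)
    ultimately show ?thesis unfolding Y_def by blast
  next
    case False
    then obtain z where z: "z \<in> X" "nbr z x" using y(1) unfolding Y_def by blast
    obtain i j where X: "(i,j) \<in> X" "nbr (i,j) x" using z by (cases z) blast
    have nb: "nbr x y" "y \<notin> H" using y by (auto simp: step_def)
    obtain a b where ab: "y = (a,b)" by (cases y)
    show ?thesis
    proof (cases "y = (i,j)")
      case True thus ?thesis using X by (simp add: Y_def)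
    next
      case False
      have "\<bar>a-i\<bar> + \<bar>b-j\<bar> = 2"
        using X(2)
      proof (cases rule: nbr_cases)
        case 1
        from nb(1)[unfolded 1] show ?thesis by (cases rule: nbr_cases) (use False ab in auto)
      next
        case 2
        from nb(1)[unfolded 2] show ?thesis by (cases rule: nbr_cases) (use False ab in auto)
      next
        case 3
        from nb(1)[unfolded 3] show ?thesis by (cases rule: nbr_cases) (use False ab in auto)
      next
        case 4
        from nb(1)[unfolded 4] show ?thesis by (cases rule: nbr_cases) (use False ab in auto)
      qed
      moreover have "a = i \<or> b = j"
      proof (rule ccontr)
        assume "\<not> (a = i \<or> b = j)"
        with calculation have "(a = i+1 \<or> a = i-1) \<and> (b = j+1 \<or> b = j-1)" by arith
        thus False using diag[OF X(1)] nb(2) unfolding ab by blast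
      qed
      ultimately have "y \<in> X" using move[OF X(1)] nb(2) unfolding ab by blast
      thus ?thesis by (simp add: Y_def)
    qed
  qed
  assume "(i,j) \<notin> H"
  hence X: "(i,j) \<in> X" "(i,j) \<in> grid n m - H" using ij by (auto simp: X_def grid_def)
  hence "linked (grid n m - H) (i,j) (0,0)" using v linked_sym by (auto simp: valid_def)
  moreover have "(i,j) \<in> Y" using X(1) by (simp add: Y_def)
  ultimately have "(0,0) \<in> Y" by (induction rule: rtranclp_induct) (use closed in blast)+
  thus False by (auto simp: Y_def X_def nbr_def)
qed

text \<open>All odd cells are holes, and cells of mixed parity are adjacent to odd ones, so every
  other hole has two even coordinates. The odd cells number \<open>(k-1)(l-1)\<close>, a quarter of
  the product for \<open>n\<close> and \<open>m\<close>, so removing them and halving keeps the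
  defect.\<close>

lemma defect_1_halve:
  assumes v: "valid n m H" and n: "n \<ge> 3" "m \<ge> 3" and c: "defect n m H = 1"
    and kl: "n = 2*k-1" "m = 2*l-1"
  shows "valid k l {(a,b). (2*a,2*b) \<in> H}" "defect k l {(a,b). (2*a,2*b) \<in> H} = 1"
proof -
  define G where "G = {(a,b). (2*a,2*b) \<in> H}"
  let ?T = "grid n m - H" and ?S = "grid k l - G"
  have odd: "(2*a+1,2*b+1) \<in> H" if "0 \<le> a" "a \<le> k-2" "0 \<le> b" "b \<le> l-2" for a b
    using defect_1_odd_cells[OF v n c, of "2*a+1" "2*b+1"] that kl by auto
  have G: "1 \<le> a" "a \<le> k-2" "1 \<le> b" "b \<le> l-2" if "(a,b) \<in> G" for a b
    using valid_interior[OF v, of "2*a" "2*b"] that kl by (auto simp: G_def)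
  \<comment> \<open>Otherwise the cell between the two doubled holes has holes on all four sides:
    these two and two odd cells.\<close>
  have iso1: "(a+1,b) \<notin> G" if "(a,b) \<in> G" for a b
  proof
    assume g: "(a+1,b) \<in> G"
    have "(2*a+1,2*b) \<in> ?T" using G[OF that] G[OF g] valid_not_nbr(1)[OF v, of "2*a" "2*b"] that kl
      by (auto simp: grid_def G_def)
    moreover have "(2*a+1,2*b) \<noteq> (0,0)" by (auto; presburger)
    ultimately obtain y where y: "nbr (2*a+1,2*b) y" "y \<in> ?T" using valid_step[OF v] by blast
    have "(2*a+1,2*b+1) \<in> H" "(2*a+1,2*b-1) \<in> H" using odd[of a b] odd[of a "b-1"] G[OF that] by auto
    with y(1) show False by (cases rule: nbr_cases) (use y(2) g that in \<open>auto simp: G_def algebra_simps\<close>)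
  qed
  have iso2: "(a,b+1) \<notin> G" if "(a,b) \<in> G" for a b
  proof
    assume g: "(a,b+1) \<in> G"
    have "(2*a,2*b+1) \<in> ?T" using G[OF that] G[OF g] valid_not_nbr(3)[OF v, of "2*a" "2*b"] that kl
      by (auto simp: grid_def G_def)
    moreover have "(2*a,2*b+1) \<noteq> (0,0)" by (auto; presburger)
    ultimately obtain y where y: "nbr (2*a,2*b+1) y" "y \<in> ?T" using valid_step[OF v] by blast
    have "(2*a+1,2*b+1) \<in> H" "(2*a-1,2*b+1) \<in> H" using odd[of a b] odd[of "a-1" b] G[OF that] by auto
    with y(1) show False by (cases rule: nbr_cases) (use y(2) g that in \<open>auto simp: G_def algebra_simps\<close>)
  qed
  have nn: "\<not> nbr x y" if "x \<in> G" "y \<in> G" for x y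
  proof
    assume nb: "nbr x y"
    obtain a b where x: "x = (a,b)" by (cases x)
    from nb[unfolded x] show False
      by (cases rule: nbr_cases) (use that x iso1[of a b] iso1[of "a-1" b] iso2[of a b] iso2[of a "b-1"] in auto)
  qed
  have ST: "(a,b) \<in> ?S" if "(2*a,2*b) \<in> ?T" for a b using that kl by (auto simp: grid_def G_def)
  \<comment> \<open>Paths alternate between even cells and cells of mixed parity. A mixed cell is
    projected to whichever of its two even neighbours the path came from, hence the
    disjunctions.\<close>
  have proj: "(\<forall>a b. x = (2*a,2*b) \<longrightarrow> linked ?S (0,0) (a,b)) \<and>
     (\<forall>a b. x = (2*a+1,2*b) \<longrightarrow> linked ?S (0,0) (a,b) \<and> (a,b) \<in> ?S \<or> linked ?S (0,0) (a+1,b) \<and> (a+1,b) \<in> ?S) \<and>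
     (\<forall>a b. x = (2*a,2*b+1) \<longrightarrow> linked ?S (0,0) (a,b) \<and> (a,b) \<in> ?S \<or> linked ?S (0,0) (a,b+1) \<and> (a,b+1) \<in> ?S)"
    if "linked ?T (0,0) x" for x
    using that
  proof (induction rule: rtranclp_induct)
    case base
    have "2 * u + 1 \<noteq> 0" for u :: int by presburger
    thus ?case by auto
  next
    case (step x y)
    obtain i j where y: "y = (i,j)" by (cases y)
    have xT: "x \<in> ?T" "y \<in> ?T" "nbr (i,j) x" using step(2) nbr_sym unfolding y by (auto simp: step_def)
    have ev: "even u \<or> even w" if T: "(u,w) \<in> ?T" for u w
    proof (rule ccontr)
      assume "\<not> (even u \<or> even w)"
      then obtain a b where "u = 2*a+1" "w = 2*b+1" by (meson oddE)
      thus False using T odd[of a b] kl by (auto simp: grid_def)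
    qed
    have g1: "linked ?S (0,0) (a,b)" if "y = (2*a,2*b)" for a b
    proof -
      have S: "(a,b) \<in> ?S" using ST xT(2) that by simp
      have *: "x = (2*a+1,2*b) \<or> x = (2*(a-1)+1,2*b) \<or> x = (2*a,2*b+1) \<or> x = (2*a,2*(b-1)+1)"
        using xT(3) that y by (cases rule: nbr_cases) auto
      have I: "x = (2*u+1,2*w) \<Longrightarrow> linked ?S (0,0) (u,w) \<and> (u,w) \<in> ?S \<or> linked ?S (0,0) (u+1,w) \<and> (u+1,w) \<in> ?S"
        "x = (2*u,2*w+1) \<Longrightarrow> linked ?S (0,0) (u,w) \<and> (u,w) \<in> ?S \<or> linked ?S (0,0) (u,w+1) \<and> (u,w+1) \<in> ?S"
        for u w using step(3) by blast+
      have nb: "nbr (a+1,b) (a,b)" "nbr (a-1,b) (a,b)" "nbr (a,b+1) (a,b)" "nbr (a,b-1) (a,b)"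
        by (simp_all add: nbr_def)
      from * show ?thesis
        using I(1)[of a b] I(1)[of "a-1" b] I(2)[of a b] I(2)[of a "b-1"] nb S linked_step
        unfolding diff_add_cancel by blast
    qed
    have g2: "linked ?S (0,0) (a,b) \<and> (a,b) \<in> ?S \<or> linked ?S (0,0) (a+1,b) \<and> (a+1,b) \<in> ?S"
      if "y = (2*a+1,2*b)" for a b
    proof -
      have *: "x = (2*(a+1),2*b) \<or> x = (2*a,2*b) \<or> x = (2*a+1,2*b+1) \<or> x = (2*a+1,2*b-1)"
        using xT(3) that y by (cases rule: nbr_cases) auto
      have "x \<noteq> (2*a+1,2*b+1)" "x \<noteq> (2*a+1,2*b-1)" using xT(1) ev by force+
      hence "x = (2*(a+1),2*b) \<or> x = (2*a,2*b)" using * by blast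
      thus ?thesis using step(3) ST xT(1) by blast
    qed
    have g3: "linked ?S (0,0) (a,b) \<and> (a,b) \<in> ?S \<or> linked ?S (0,0) (a,b+1) \<and> (a,b+1) \<in> ?S"
      if "y = (2*a,2*b+1)" for a b
    proof -
      have *: "x = (2*a,2*(b+1)) \<or> x = (2*a,2*b) \<or> x = (2*a+1,2*b+1) \<or> x = (2*a-1,2*b+1)"
        using xT(3) that y by (cases rule: nbr_cases) auto
      have "x \<noteq> (2*a+1,2*b+1)" "x \<noteq> (2*a-1,2*b+1)" using xT(1) ev by force+
      hence "x = (2*a,2*(b+1)) \<or> x = (2*a,2*b)" using * by blast
      thus ?thesis using step(3) ST xT(1) by blast
    qed
    show ?case using g1 g2 g3 by blast
  qed
  have "linked ?S (0,0) (a,b)" if "(a,b) \<in> ?S" for a b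
  proof -
    have "(2*a,2*b) \<in> ?T" using that kl by (auto simp: grid_def G_def)
    hence "linked ?T (0,0) (2*a,2*b)" using v by (simp add: valid_def)
    thus ?thesis using proj by blast
  qed
  thus "valid k l {(a,b). (2*a,2*b) \<in> H}" unfolding G_def[symmetric] valid_def using G nn by auto
  let ?o = "\<lambda>(a,b). (2*a+1,2*b+1) :: cell" and ?e = "\<lambda>(a,b). (2*a,2*b) :: cell"
  let ?A = "?o ` ({0..<k-1} \<times> {0..<l-1})"
  have "H = ?A \<union> ?e ` G"
  proof
    show "?A \<union> ?e ` G \<subseteq> H" using odd by (auto simp: G_def)
    show "H \<subseteq> ?A \<union> ?e ` G"
    proof
      fix x assume x: "x \<in> H"
      obtain i j where ij: "x = (i,j)" by (cases x)
      note bd = valid_interior[OF v x[unfolded ij]]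
      note nb = valid_not_nbr[OF v x[unfolded ij]]
      consider "even i" "even j" | "even i" "odd j" | "odd i" "even j" | "odd i" "odd j" by blast
      thus "x \<in> ?A \<union> ?e ` G"
      proof cases
        case 1
        then obtain a b where "i = 2*a" "j = 2*b" by (meson evenE)
        thus ?thesis using x ij by (force simp: G_def)
      next
        case 2
        have "i - 1 \<ge> 1" using 2 bd by presburger
        hence "(i-1,j) \<in> H" using 2 bd by (intro defect_1_odd_cells[OF v n c]) auto
        thus ?thesis using nb by blast
      next
        case 3
        have "j - 1 \<ge> 1" using 3 bd by presburger
        hence "(i,j-1) \<in> H" using 3 bd by (intro defect_1_odd_cells[OF v n c]) auto
        thus ?thesis using nb by blast
      next
        case 4
        then obtain a b where "i = 2*a+1" "j = 2*b+1" by (meson oddE)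
        thus ?thesis using ij bd kl by force
      qed
    qed
  qed
  moreover have "?A \<inter> ?e ` G = {}" by auto presburger
  moreover have "finite G" by (rule finite_subset[of _ "{1..k-2} \<times> {1..l-2}"]) (use G in auto)
  ultimately have "card H = card ?A + card (?e ` G)" by (simp add: card_Un_disjoint)
  also have "card ?A = card ({0..<k-1} \<times> {0..<l-1})" by (rule card_image) (auto simp: inj_on_def)
  also have "card (?e ` G) = card G" by (rule card_image) (auto simp: inj_on_def)
  finally have "int (card H) = (k-1)*(l-1) + int (card G)" using n kl
    by (simp add: card_cartesian_product)
  thus "defect k l {(a,b). (2*a,2*b) \<in> H} = 1" unfolding G_def[symmetric] using c kl
    by (simp add: defect_def algebra_simps)
qed

text \<open>Halving sends \<open>n - 1\<close> to \<open>(n - 1) / 2\<close> and ends when a side is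
  2; there no hole fits, so the product is 1 and the grid is 2 by 2.\<close>

lemma defect_1_size:
  assumes "valid n m H" "n \<ge> 2" "m \<ge> 2" "defect n m H = 1"
  shows "m = n \<and> (\<exists>l::nat. n = 2^l + 1)"
  using assms
proof (induction "nat n" arbitrary: n m H rule: less_induct)
  case less
  note v = less(2) and c = less(5)
  show ?case
  proof (cases "n = 2 \<or> m = 2")
    case True
    hence "H = {}" using valid_interior[OF v] by fastforce
    hence "(n-1)*(m-1) = 1" using c by (simp add: defect_def)
    hence "n = 2 \<and> m = 2" using True by auto
    thus ?thesis by (auto intro!: exI[of _ 0])
  next
    case False
    hence n: "n \<ge> 3" "m \<ge> 3" using less by auto
    define k l where "k = (n+1) div 2" and "l = (m+1) div 2"
    have kl: "n = 2*k-1" "m = 2*l-1" using defect_1_odd[OF v n c] unfolding k_def l_def by presburger+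
    have "l = k \<and> (\<exists>l::nat. k = 2^l + 1)"
      by (rule less(1)[OF _ defect_1_halve(1)[OF v n c kl] _ _ defect_1_halve(2)[OF v n c kl]]) (use kl n in auto)
    then obtain i :: nat where "l = k" "k = 2^i + 1" by auto
    hence "m = n" "n = 2^(Suc i) + 1" using kl by auto
    thus ?thesis by blast
  qed
qed

section \<open>Excluding defect 2 for \<open>n\<close> by \<open>n+1\<close>\<close>

text \<open>Holes along a side that start and end with a hole and leave no two consecutive places
  free occupy exactly the odd places.\<close>

lemma alternating_odd:
  fixes M :: int
  assumes "P 1" "P (M-2)" "M \<ge> 3"
    and "\<And>j. 1 \<le> j \<Longrightarrow> j \<le> M-3 \<Longrightarrow> P j \<or> P (j+1)" "\<And>j. P j \<Longrightarrow> \<not> P (j+1)"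
  shows "odd M"
proof -
  have "1 \<le> j \<Longrightarrow> j \<le> M-2 \<longrightarrow> (P j \<longleftrightarrow> odd j)" for j
  proof (induction j rule: int_ge_induct)
    case base thus ?case using assms by simp
  next
    case (step j) thus ?case using assms(4)[of j] assms(5)[of j] by auto
  qed
  from this[of "M-2"] show ?thesis using assms by simp
qed

text \<open>If every square contains a hole, the holes alternate along two sides and both
  \<open>n\<close> and \<open>n+1\<close> would be odd. Otherwise an untouched square
  \<open>x\<close>, its complement and the two trivial cuts are all the cuts, so
  \<open>even_touched\<close> is empty or everything but \<open>x\<close>; in both cases two
  distinct corner squares would have to equal \<open>x\<close>.\<close>

lemma defect_not_2:
  assumes v: "valid n (n+1) H" and n: "n \<ge> 3"
  shows "defect n (n+1) H \<noteq> 2"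
proof
  assume c: "defect n (n+1) H = 2"
  define B where "B = blocks n (n+1)"
  have c4: "card (cuts n (n+1) H) \<le> 4" using card_cuts[OF v] c n by simp
  have bl: "(0,0) \<in> B" "(n-2,0) \<in> B" "(0,n-1) \<in> B" "(n-2,n-1) \<in> B" using n by (auto simp: B_def blocks_def)
  note ct = corner_touched[OF v, simplified]
  show False
  proof (cases "B \<subseteq> touched H")
    case True
    have "odd n"
    proof (rule alternating_odd[where P = "\<lambda>i. (i,1) \<in> H"])
      show "(1,1) \<in> H" "(n-2,1) \<in> H" using ct True bl by auto
      show "(j,1) \<in> H \<or> (j+1,1) \<in> H" if "1 \<le> j" "j \<le> n-3" for j
      proof -
        have "(j,0) \<in> touched H" using True that n by (auto simp: B_def blocks_def)
        thus ?thesis using valid_interior[OF v] by (force simp: touched_def)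
      qed
    qed (use n valid_not_nbr[OF v] in auto)
    moreover have "odd (n+1)"
    proof (rule alternating_odd[where P = "\<lambda>j. (1,j) \<in> H"])
      show "(1,1) \<in> H" "(1,n+1-2) \<in> H" using ct True bl by auto
      show "(1,j) \<in> H \<or> (1,j+1) \<in> H" if "1 \<le> j" "j \<le> n+1-3" for j
      proof -
        have "(0,j) \<in> touched H" using True that n by (auto simp: B_def blocks_def)
        thus ?thesis using valid_interior[OF v] by (force simp: touched_def)
      qed
    qed (use n valid_not_nbr[OF v] in auto)
    ultimately show False by simp
  next
    case False
    then obtain x where x: "x \<in> B" "x \<notin> touched H" by blast
    let ?C = "{{}, B, {x}, B - {x}}"
    have sub: "?C \<subseteq> cuts n (n+1) H"
      using empty_in_cuts blocks_in_cuts[OF v] untouched_in_cuts[OF x[unfolded B_def]]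
        Diff_in_cuts[OF v untouched_in_cuts[OF x[unfolded B_def]]] by (auto simp: B_def)
    have d3: "(0,0) \<noteq> (n-2,0::int)" "(0,0) \<noteq> (0::int,n-1)" "(n-2,0) \<noteq> (0,n-1)" using n by auto
    obtain y z where yz: "y \<in> B" "z \<in> B" "y \<noteq> x" "z \<noteq> x" "y \<noteq> z"
      using bl(1,2,3) d3 by metis
    have ne: "{} \<noteq> B" "{} \<noteq> {x}" "{} \<noteq> B - {x}" "B \<noteq> {x}" "B \<noteq> B - {x}" "{x} \<noteq> B - {x}"
      using x yz by blast+
    hence "card ?C = 4" by simp
    hence C: "cuts n (n+1) H = ?C" using sub c4 by (intro card_seteq[symmetric] finite_cuts) auto
    have uniq: "b = x" if "b \<in> B" "b \<notin> touched H" for b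
    proof -
      have "{b} \<in> ?C" using untouched_in_cuts[OF that[unfolded B_def]] unfolding C .
      moreover have "{b} \<noteq> B" "{b} \<noteq> B - {x}" using yz by (metis DiffI singletonD)+
      ultimately show ?thesis by simp
    qed
    define E where "E = even_touched n (n+1) H"
    have "E \<in> ?C" unfolding E_def C[symmetric] by (rule even_touched_in_cuts[OF v])
    moreover have "x \<notin> E" unfolding E_def by (rule untouched_not_even[OF x(2)])
    ultimately have E: "E = {} \<or> E = B - {x}" using x by blast
    have out: "(0,j) \<notin> H" "(j,0) \<notin> H" "(n-1,j) \<notin> H" "(j,n) \<notin> H" for j
      using valid_interior[OF v, of 0 j] valid_interior[OF v, of j 0] valid_interior[OF v, of "n-1" j]
        valid_interior[OF v, of j n] by auto
    \<comment> \<open>In the corner squares the possible holes are \<open>(1,1)\<close>, even;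
      \<open>(n-2,n-1)\<close>, of odd sum \<open>2n-3\<close>; and \<open>(n-2,1)\<close> and
      \<open>(1,n-1)\<close>, exactly one of them even.\<close>
    have ee: "(0,0) \<in> E \<longleftrightarrow> (1,1) \<in> H" "(n-2,0) \<in> E \<longleftrightarrow> (n-2,1) \<in> H \<and> odd n"
      "(0,n-1) \<in> E \<longleftrightarrow> (1,n-1) \<in> H \<and> even n" "(n-2,n-1) \<notin> E"
      using bl out unfolding E_def B_def by (simp_all add: even_touched_def)
    show False
    proof (cases "E = {}")
      case True
      have "x = (0,0)" using uniq[OF bl(1)] ee(1) ct(1) True by simp
      moreover have "odd n \<Longrightarrow> x = (n-2,0)" using uniq[OF bl(2)] ee(2) ct(2) True by simp
      moreover have "even n \<Longrightarrow> x = (0,n-1)" using uniq[OF bl(3)] ee(3) ct(3) True by simp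
      ultimately show False using n by auto
    next
      case False
      hence *: "b = x" if "b \<in> B" "b \<notin> E" for b using E that by blast
      have "x = (n-2,n-1)" using *[OF bl(4)] ee(4) by simp
      moreover have "odd n \<Longrightarrow> x = (0,n-1)" using *[OF bl(3)] ee(3) by simp
      moreover have "even n \<Longrightarrow> x = (n-2,0)" using *[OF bl(2)] ee(2) by simp
      ultimately show False using n by auto
    qed
  qed
qed

section \<open>Constructions\<close>

lemma linked_trans: "linked T x y \<Longrightarrow> linked T y z \<Longrightarrow> linked T x z"
  by (rule rtranclp_trans)

lemma linked_nbr: "x \<in> T \<Longrightarrow> y \<in> T \<Longrightarrow> nbr x y \<Longrightarrow> linked T x y"
  by (simp add: r_into_rtranclp step_def)

lemma linked_row:
  assumes "a \<le> b" "\<And>k. a \<le> k \<Longrightarrow> k \<le> b \<Longrightarrow> (i,k) \<in> T"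
  shows "linked T (i,a) (i,b)"
  using assms
proof (induction b rule: int_ge_induct)
  case (step b)
  have "linked T (i,a) (i,b)" using step by simp
  thus ?case by (rule linked_step) (use step in auto)
qed simp

lemma linked_col:
  assumes "a \<le> b" "\<And>k. a \<le> k \<Longrightarrow> k \<le> b \<Longrightarrow> (k,j) \<in> T"
  shows "linked T (a,j) (b,j)"
  using assms
proof (induction b rule: int_ge_induct)
  case (step b)
  have "linked T (a,j) (b,j)" using step by simp
  thus ?case by (rule linked_step) (use step in auto)
qed simp

definition border :: "int \<Rightarrow> int \<Rightarrow> cell set" where
  "border n m = {(i,j) \<in> grid n m. i = 0 \<or> j = 0 \<or> i = n-1 \<or> j = m-1}"

lemma border_linked:
  assumes H: "H \<subseteq> {1..n-2} \<times> {1..m-2}" and x: "x \<in> border n m"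
  shows "linked (grid n m - H) (0,0) x"
proof -
  let ?T = "grid n m - H"
  obtain i j where ij: "x = (i,j)" by (cases x)
  have b: "0 \<le> i" "i < n" "0 \<le> j" "j < m" using x by (auto simp: border_def grid_def ij)
  have T: "(a,c) \<in> ?T" if "0 \<le> a" "a < n" "0 \<le> c" "c < m" "a = 0 \<or> c = 0 \<or> a = n-1 \<or> c = m-1" for a c
    using that H by (auto simp: grid_def)
  have "linked ?T (0,0) (i,0)" by (rule linked_col, use b in simp, rule T) (use b in auto)
  moreover have "linked ?T (0,0) (0,j)" by (rule linked_row, use b in simp, rule T) (use b in auto)
  moreover have "linked ?T (i,0) (i,j)" if "i = n-1" by (rule linked_row, use b that in simp, rule T) (use b that in auto)
  moreover have "linked ?T (0,j) (i,j)" if "j = m-1" by (rule linked_col, use b that in simp, rule T) (use b that in auto)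
  moreover have "i = 0 \<or> j = 0 \<or> i = n-1 \<or> j = m-1" using x by (auto simp: border_def ij)
  ultimately show ?thesis unfolding ij using linked_trans by blast
qed

lemma validI:
  assumes H: "H \<subseteq> {1..n-2} \<times> {1..m-2}"
    and adj: "\<And>i j. (i,j) \<in> H \<Longrightarrow> (i+1,j) \<notin> H" "\<And>i j. (i,j) \<in> H \<Longrightarrow> (i,j+1) \<notin> H"
    and lk: "\<And>i j. (i,j) \<in> grid n m - H \<Longrightarrow> (i,j) \<notin> border n m \<Longrightarrow> linked (grid n m - H) (0,0) (i,j)"
  shows "valid n m H"
proof -
  have "\<not> nbr x y" if "x \<in> H" "y \<in> H" for x y
  proof
    assume nb: "nbr x y"
    obtain i j where x: "x = (i,j)" by (cases x)
    from nb[unfolded x] show False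
      by (cases rule: nbr_cases) (use that x adj(1)[of i j] adj(1)[of "i-1" j] adj(2)[of i j] adj(2)[of i "j-1"] in auto)
  qed
  moreover have "linked (grid n m - H) (0,0) (i,j)" if "(i,j) \<in> grid n m - H" for i j
    using lk[OF that] border_linked[OF H] by blast
  ultimately show ?thesis using H by (auto simp: valid_def)
qed

lemma valid_image:
  assumes v: "valid n m H" and o: "n \<ge> 1" "m \<ge> 1" and inj: "inj f" and g: "f ` grid n m = grid n' m'"
    and int: "f ` ({1..n-2} \<times> {1..m-2}) \<subseteq> {1..n'-2} \<times> {1..m'-2}"
    and nb: "\<And>x y. nbr (f x) (f y) \<longleftrightarrow> nbr x y"
  shows "valid n' m' (f ` H)"
proof -
  let ?T = "grid n m - H" and ?S = "grid n' m' - f ` H"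
  have S: "?S = f ` ?T" using g inj by (simp add: image_set_diff)
  have lf: "linked ?S (f x) (f y)" if "linked ?T x y" for x y
    using that
  proof (induction rule: rtranclp_induct)
    case (step y z)
    show ?case by (rule linked_step[OF step(3)]) (use step(2) S nb in \<open>auto simp only: step_def image_eqI\<close>)
  qed simp
  have int': "f ` H \<subseteq> {1..n'-2} \<times> {1..m'-2}" using int v unfolding valid_def by blast
  have "(0,0) \<in> grid n m" using o by (auto simp: grid_def)
  hence g0: "grid n' m' \<noteq> {}" using g by blast
  hence "(0,0) \<in> ?S" using int' by (force simp: grid_def)
  \<comment> \<open>The map need not fix \<open>(0,0)\<close>, so paths are routed through the
    preimage of this corner.\<close>
  then obtain z where z: "z \<in> ?T" "(0,0) = f z" unfolding S by blast
  have "linked ?S (0,0) x" if x: "x \<in> ?S" for x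
  proof -
    obtain w where w: "w \<in> ?T" "x = f w" using x unfolding S by blast
    have l: "linked ?T (0,0) u" if "u \<in> ?T" for u using v that unfolding valid_def by blast
    from lf[OF linked_trans[OF linked_sym[OF l[OF z(1)]] l[OF w(1)]]] show ?thesis
      unfolding z(2)[symmetric] w(2) .
  qed
  moreover have "\<not> nbr x y" if "x \<in> f ` H" "y \<in> f ` H" for x y
    using that nb v unfolding valid_def by blast
  ultimately show ?thesis using int' by (simp add: valid_def)
qed

lemma valid_mirror:
  assumes v: "valid n m H" and o: "n \<ge> 1" "m \<ge> 1"
  shows "valid n m ((\<lambda>(i,j). (i,m-1-j)) ` H)"
proof (rule valid_image[OF v o])
  show "(\<lambda>(i,j). (i,m-1-j)) ` grid n m = grid n m"
  proof
    show "grid n m \<subseteq> (\<lambda>(i,j). (i,m-1-j)) ` grid n m"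
    proof
      fix x assume "x \<in> grid n m"
      thus "x \<in> (\<lambda>(i,j). (i,m-1-j)) ` grid n m"
        by (intro image_eqI[of _ _ "(fst x, m-1-snd x)"]) (auto simp: grid_def)
    qed
  qed (auto simp: grid_def)
qed (auto simp: nbr_def inj_def)

lemma valid_antitranspose:
  assumes v: "valid n m H" and o: "n \<ge> 1" "m \<ge> 1"
  shows "valid m n ((\<lambda>(i,j). (m-1-j,n-1-i)) ` H)"
proof (rule valid_image[OF v o])
  show "(\<lambda>(i,j). (m-1-j,n-1-i)) ` grid n m = grid m n"
  proof
    show "grid m n \<subseteq> (\<lambda>(i,j). (m-1-j,n-1-i)) ` grid n m"
    proof
      fix x assume "x \<in> grid m n"
      thus "x \<in> (\<lambda>(i,j). (m-1-j,n-1-i)) ` grid n m"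
        by (intro image_eqI[of _ _ "(n-1-snd x, m-1-fst x)"]) (auto simp: grid_def)
    qed
  qed (auto simp: grid_def)
qed (auto simp: nbr_def inj_def)

section \<open>Extension by three rows\<close>

text \<open>Extending a configuration by three rows makes \<open>(n-1,1)\<close> a hole, so \<open>(n-2,1)\<close> must not be one.\<close>

definition attainable :: "int \<Rightarrow> int \<Rightarrow> int \<Rightarrow> bool" where
  "attainable n m c \<longleftrightarrow> n \<ge> 3 \<and> m \<ge> 3 \<and> (\<exists>H. valid n m H \<and> defect n m H = c \<and> (n-2,1) \<notin> H)"

text \<open>This reflection takes the reserved cell \<open>(n-2,1)\<close> to
  \<open>(m-2,1)\<close>, the reserved cell of the new shape; plain transposition would take it to
  \<open>(1,n-2)\<close>.\<close>

lemma attainable_antitranspose: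
  assumes "attainable n m c"
  shows "attainable m n c"
proof -
  obtain H where H: "n \<ge> 3" "m \<ge> 3" "valid n m H" "defect n m H = c" "(n-2,1) \<notin> H"
    using assms by (auto simp: attainable_def)
  let ?f = "\<lambda>(i,j). (m-1-j,n-1-i) :: cell"
  have "card (?f ` H) = card H" by (rule card_image) (auto simp: inj_on_def)
  hence "defect m n (?f ` H) = c" using H by (simp add: defect_def mult.commute)
  moreover have "(m-2,1) \<notin> ?f ` H"
  proof
    assume "(m-2,1) \<in> ?f ` H"
    then obtain i j where ij: "(i,j) \<in> H" "m-2 = m-1-j" "1 = n-1-i" by auto
    hence "i = n-2" "j = 1" by auto
    thus False using ij(1) H(5) by simp
  qed
  ultimately show ?thesis using H valid_antitranspose[OF H(3)] unfolding attainable_def by auto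
qed

text \<open>The new holes are \<open>(n-1,1)\<close> and a zigzag in rows \<open>n\<close> and
  \<open>n+1\<close>: \<open>1 + (m-2)\<close> holes, a third of the growth of the product. The odd
  positions of the zigzag lie in row \<open>n+1\<close>, away from \<open>(n-1,1)\<close>; for even
  \<open>m\<close> it therefore ends in row \<open>n\<close> and leaves \<open>(n+1,m-2)\<close>
  free.\<close>

lemma extend:
  assumes "attainable n m c"
  shows "\<exists>H. valid (n+3) m H \<and> defect (n+3) m H = c \<and> (even m \<longrightarrow> (n+1,m-2) \<notin> H)"
proof -
  obtain H where H: "n \<ge> 3" "m \<ge> 3" "valid n m H" "defect n m H = c" "(n-2,1) \<notin> H"
    using assms by (auto simp: attainable_def)
  note int = valid_interior[OF H(3)] and vn = valid_not_nbr[OF H(3)]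
  let ?z = "\<lambda>j::int. if even j then (n,j) else (n+1,j)"
  define K where "K = insert (n-1,1) H \<union> ?z ` {1..m-2}"
  have K: "(i,j) \<in> K \<longleftrightarrow> (i,j) \<in> H \<or> i = n-1 \<and> j = 1 \<or> i = n \<and> even j \<and> 1 \<le> j \<and> j \<le> m-2
     \<or> i = n+1 \<and> odd j \<and> 1 \<le> j \<and> j \<le> m-2" for i j
    by (auto simp: K_def image_iff)
  have top: "(i,j) \<notin> H" if "i \<ge> n-1" for i j using that int[of i j] by auto
  let ?T = "grid n m - H" and ?S = "grid (n+3) m - K"
  have "1 \<le> i \<and> i \<le> n+1 \<and> 1 \<le> j \<and> j \<le> m-2" if "(i,j) \<in> K" for i j
    using that int[of i j] H(1,2) unfolding K by auto
  hence Kint: "K \<subseteq> {1..n+3-2} \<times> {1..m-2}" by (intro subrelI) (simp add: add.commute)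
  have bd: "linked ?S (0,0) x" if "x \<in> border (n+3) m" for x
    by (rule border_linked[OF Kint that])
  \<comment> \<open>The hole \<open>(n-1,1)\<close> interrupts the former border row, whose
    remainder keeps contact through its far end \<open>(n-1,m-1)\<close>.\<close>
  have R: "linked ?S (0,0) (n-1,j)" if "2 \<le> j" "j \<le> m-1" for j
  proof -
    have "linked ?S (n-1,j) (n-1,m-1)"
      by (rule linked_row) (use that H top in \<open>auto simp: K grid_def\<close>)
    moreover have "(n-1,m-1) \<in> border (n+3) m" using H by (auto simp: border_def grid_def)
    ultimately show ?thesis using bd linked_sym linked_trans by blast
  qed
  \<comment> \<open>Old paths survive except where they pass through \<open>(n-1,1)\<close>; the
    cell after it is reached from the border or by \<open>R\<close>.\<close>
  have old: "x \<noteq> (n-1,1) \<longrightarrow> linked ?S (0,0) x" if "linked ?T (0,0) x" for x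
    using that
  proof (induction rule: rtranclp_induct)
    case (step x y)
    show ?case
    proof
      assume y: "y \<noteq> (n-1,1)"
      have sub: "z \<in> ?S" if "z \<in> ?T" "z \<noteq> (n-1,1)" for z
        using that by (cases z) (auto simp: K grid_def)
      have st: "x \<in> ?T" "y \<in> ?T" "nbr x y" using step(2) by (auto simp: step_def)
      show "linked ?S (0,0) y"
      proof (cases "x = (n-1,1)")
        case False
        thus ?thesis using linked_step[OF _ sub sub] step(3) st y by blast
      next
        case True
        from st(3)[unfolded True] show ?thesis
        proof (cases rule: nbr_cases)
          case 1
          thus ?thesis using st(2) by (auto simp: grid_def)
        next
          case 2
          have "(n-2,0) \<in> border (n+3) m" using H by (auto simp: border_def grid_def)
          moreover have "(n-2,0) \<in> ?S" using H(1,2) int[of "n-2" 0] by (auto simp: K grid_def)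
          ultimately show ?thesis using linked_step[OF bd _ sub[OF st(2) y]] 2 by (simp add: nbr_def)
        next
          case 3
          thus ?thesis using R[of 2] H by simp
        next
          case 4
          thus ?thesis using H by (intro bd) (auto simp: border_def grid_def)
        qed
      qed
    qed
  qed simp
  have "valid (n+3) m K"
  proof (rule validI[OF Kint])
    fix i j assume "(i,j) \<in> K"
    thus "(i+1,j) \<notin> K" "(i,j+1) \<notin> K" using vn H(1,2,5) top int[of i j] unfolding K by auto
  next
    fix i j assume S: "(i,j) \<in> ?S" and nb: "(i,j) \<notin> border (n+3) m"
    have b: "1 \<le> i" "i \<le> n+1" "1 \<le> j" "j \<le> m-2" using S nb by (auto simp: grid_def border_def)
    \<comment> \<open>New free cells: odd \<open>j\<close> in row \<open>n\<close> hang on row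
      \<open>n-1\<close>, or on the border if \<open>j = 1\<close>; even \<open>j\<close> in row
      \<open>n+1\<close> hang on the new border row \<open>n+2\<close>.\<close>
    consider "i < n" | "i = n" "odd j" "j = 1" | "i = n" "odd j" "2 \<le> j" | "i = n+1" "even j"
      using b S by (auto simp: K) linarith+
    thus "linked ?S (0,0) (i,j)"
    proof cases
      case 1
      hence "(i,j) \<in> ?T" "(i,j) \<noteq> (n-1,1)" using S b by (auto simp: K grid_def)
      thus ?thesis using old H(3) by (auto simp: valid_def)
    next
      case 2
      have "(n,0) \<in> border (n+3) m" "(n,0) \<in> ?S" using H(1,2) int[of n 0] by (auto simp: K grid_def border_def)
      thus ?thesis using linked_step[OF bd _ S] 2 by (simp add: nbr_def)
    next
      case 3
      have "(n-1,j) \<in> ?S" using 3 H b top by (auto simp: K grid_def)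
      thus ?thesis using linked_step[OF R _ S] 3 b by (simp add: nbr_def)
    next
      case 4
      have "(n+2,j) \<in> border (n+3) m" "(n+2,j) \<in> ?S" using H b top by (auto simp: K grid_def border_def)
      thus ?thesis using linked_step[OF bd _ S] 4 by (simp add: nbr_def)
    qed
  qed
  moreover have "defect (n+3) m K = c"
  proof -
    have "card (?z ` {1..m-2}) = card {1..m-2}" by (rule card_image) (auto simp: inj_on_def split: if_splits)
    moreover have "insert (n-1,1) H \<inter> ?z ` {1..m-2} = {}" using top by (auto split: if_splits)
    moreover have "finite H" "(n-1,1) \<notin> H" using valid_finite[OF H(3)] top by auto
    ultimately have "card K = Suc (card H) + nat (m-2)" unfolding K_def by (simp add: card_Un_disjoint)
    hence "int (card K) = int (card H) + (m-1)" using H by simp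
    thus ?thesis using H(4) by (simp add: defect_def algebra_simps)
  qed
  moreover have "even m \<longrightarrow> (n+1,m-2) \<notin> K" using top by (auto simp: K)
  ultimately show ?thesis by blast
qed

text \<open>A mirror image moves the free cell \<open>(n+1,m-2)\<close> to the reserved place
  \<open>(n+1,1)\<close>.\<close>

lemma attainable_extend:
  assumes "attainable n m c" "even m"
  shows "attainable (n+3) m c"
proof -
  obtain H where H: "valid (n+3) m H" "defect (n+3) m H = c" "(n+1,m-2) \<notin> H"
    using extend[OF assms(1)] assms(2) by auto
  have nm: "n \<ge> 3" "m \<ge> 3" using assms by (auto simp: attainable_def)
  define K where "K = (\<lambda>(i,j). (i,m-1-j)) ` H"
  have "card K = card H" unfolding K_def by (rule card_image) (auto simp: inj_on_def)
  hence "defect (n+3) m K = c" using H by (simp add: defect_def)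
  moreover have "(n+1,1) \<notin> K"
  proof
    assume "(n+1,1) \<in> K"
    hence "(n+1,1) \<in> (\<lambda>(i,j). (i,m-1-j)) ` H" by (simp add: K_def)
    then obtain j where j: "(n+1,j) \<in> H" "1 = m-1-j" by auto
    hence "j = m-2" by auto
    thus False using j(1) H(3) by simp
  qed
  moreover have "valid (n+3) m K" unfolding K_def using nm by (intro valid_mirror[OF H(1)]) auto
  ultimately show ?thesis using nm unfolding attainable_def by (auto intro!: exI[of _ K] simp: add.commute)
qed

text \<open>Two extensions at a time preserve the parity of \<open>n\<close>, so that both sides can
  be enlarged in turn.\<close>

lemma attainable_extend_6:
  assumes "attainable n m c" "even m"
  shows "attainable (n + 6 * int k) m c"
proof (induction k)
  case (Suc k)
  have "attainable (n + 6 * int k + 3 + 3) m c" by (intro attainable_extend Suc assms)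
  thus ?case by (simp add: algebra_simps)
qed (use assms in simp)

lemma attainable_extend_6_6:
  assumes "attainable n m c" "even n" "even m"
  shows "attainable (n + 6 * int k) (m + 6 * int l) c"
  by (intro attainable_antitranspose[OF attainable_extend_6] attainable_antitranspose[of "n + _"] attainable_extend_6 assms)
    (use assms in auto)

section \<open>Starting configurations\<close>

text \<open>In a grid with 3 or 4 rows every inner cell is adjacent to the border, which makes
  connectivity automatic.\<close>

lemma valid_shallow:
  assumes n: "n = 3 \<or> n = 4" and H: "H \<subseteq> {1..n-2} \<times> {1..m-2}"
    and adj: "\<And>i j. (i,j) \<in> H \<Longrightarrow> (i+1,j) \<notin> H" "\<And>i j. (i,j) \<in> H \<Longrightarrow> (i,j+1) \<notin> H"
  shows "valid n m H"
proof (rule validI[OF H adj])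
  fix i j assume S: "(i,j) \<in> grid n m - H" "(i,j) \<notin> border n m"
  hence "1 \<le> i" "i \<le> n-2" "0 \<le> j" "j < m" by (auto simp: grid_def border_def)
  hence "(i-1 = 0 \<or> i+1 = n-1) \<and> 0 \<le> j \<and> j < m" using n by auto
  hence "(i-1,j) \<in> border n m \<or> (i+1,j) \<in> border n m" using n by (auto simp: border_def grid_def)
  moreover have "nbr (i-1,j) (i,j)" "nbr (i+1,j) (i,j)" by (simp_all add: nbr_def)
  ultimately obtain y where y: "y \<in> border n m" "nbr y (i,j)" by blast
  have "y \<in> grid n m - H" using y(1) H by (auto simp: border_def)
  from linked_step[OF border_linked[OF H y(1)] this S(1) y(2)] show "linked (grid n m - H) (0,0) (i,j)" .
qed

lemma attainable_4_4: "attainable 4 4 3"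
  unfolding attainable_def
  by (auto intro!: exI[of _ "{(1,1),(2,2)}"] valid_shallow simp: defect_def)

lemma attainable_4_6: "attainable 4 6 3"
  unfolding attainable_def
  by (auto intro!: exI[of _ "{(1,1),(2,2),(1,3),(2,4)}"] valid_shallow simp: defect_def)

lemma attainable_4_8: "attainable 4 8 3"
  unfolding attainable_def
  by (auto intro!: exI[of _ "{(1,1),(2,2),(1,3),(2,4),(1,5),(2,6)}"] valid_shallow simp: defect_def)

lemma attainable_3_5: "attainable 3 5 5"
  unfolding attainable_def
  by (auto intro!: exI[of _ "{(1,2)}"] valid_shallow simp: defect_def)

text \<open>With three rows the reserved cell is \<open>(1,1)\<close>, so the starting holes occupy
  even positions.\<close>

lemma attainable_6_6: "attainable 6 6 4"
proof -
  have "attainable 3 6 4" unfolding attainable_def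
    by (auto intro!: exI[of _ "{(1,2),(1,4)}"] valid_shallow simp: defect_def)
  from attainable_extend[OF this] show ?thesis by simp
qed

lemma attainable_6_8: "attainable 6 8 5"
proof -
  have "attainable 3 8 5" unfolding attainable_def
    by (auto intro!: exI[of _ "{(1,2),(1,4),(1,6)}"] valid_shallow simp: defect_def)
  from attainable_extend[OF this] show ?thesis by simp
qed

lemma attainable_8_8: "attainable 8 8 4"
proof -
  \<comment> \<open>Eight holes in a 5 by 8 grid give defect 28 - 24 = 4. The inner cells
    \<open>(2,2)\<close>, \<open>(2,3)\<close>, \<open>(2,4)\<close> reach the border through
    \<open>(1,3)\<close>.\<close>
  let ?H = "{(1,2),(1,4),(1,6),(2,1),(2,5),(3,2),(3,4),(3,6)} :: cell set"
  let ?T = "grid 5 8 - ?H"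
  have int: "?H \<subseteq> {1..5-2} \<times> {1..8-2}" by auto
  have up: "linked ?T (0,0) (1,j)" if "(1,j) \<in> ?T" for j
    by (rule linked_step[OF border_linked[OF int, of "(0,j)"] _ that])
      (use that in \<open>auto simp: border_def grid_def nbr_def\<close>)
  have down: "linked ?T (0,0) (3,j)" if "(3,j) \<in> ?T" for j
    by (rule linked_step[OF border_linked[OF int, of "(4,j)"] _ that])
      (use that in \<open>auto simp: border_def grid_def nbr_def\<close>)
  have r3: "linked ?T (0,0) (2,3)"
    by (rule linked_step[OF up[of 3]]) (auto simp: grid_def nbr_def)
  have "linked ?T (0,0) (2,2)" "linked ?T (0,0) (2,4)"
    by (rule linked_step[OF r3]; simp add: grid_def nbr_def)+
  moreover have "linked ?T (0,0) (2,6)"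
    by (rule linked_step[OF border_linked[OF int, of "(2,7)"]]) (auto simp: border_def grid_def nbr_def)
  ultimately have mid: "linked ?T (0,0) (2,j)" if "(2,j) \<in> ?T" "1 \<le> j" "j \<le> 6" for j
  proof -
    have "j = 1 \<or> j = 2 \<or> j = 3 \<or> j = 4 \<or> j = 5 \<or> j = 6" using that by arith
    thus ?thesis using that r3 \<open>linked ?T (0,0) (2,2)\<close> \<open>linked ?T (0,0) (2,4)\<close> \<open>linked ?T (0,0) (2,6)\<close> by auto
  qed
  have "valid 5 8 ?H"
  proof (rule validI[OF int])
    fix i j assume S: "(i,j) \<in> ?T" "(i,j) \<notin> border 5 8"
    have "(i,j) \<in> grid 5 8" using S(1) by blast
    hence j: "1 \<le> j" "j \<le> 6" and i: "i = 1 \<or> i = 2 \<or> i = 3" using S(2) by (auto simp: border_def grid_def)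
    from i consider (1) "i = 1" | (2) "i = 2" | (3) "i = 3" by blast
    thus "linked ?T (0,0) (i,j)"
    proof cases
      case 1 show ?thesis unfolding 1 by (rule up[OF S(1)[unfolded 1]])
    next
      case 2 show ?thesis unfolding 2 by (rule mid[OF S(1)[unfolded 2] j])
    next
      case 3 show ?thesis unfolding 3 by (rule down[OF S(1)[unfolded 3]])
    qed
  qed auto
  hence "attainable 5 8 4" unfolding attainable_def
    by (intro conjI exI[of _ ?H]) (auto simp: defect_def)
  from attainable_extend[OF this] show ?thesis by simp
qed

section \<open>Doubling a configuration of defect 1\<close>

text \<open>Inverse of \<open>defect_1_halve\<close>: \<open>(k-1)(k-1)\<close> odd cells become
  holes and the old holes are doubled. A step in the small grid becomes two steps, through a cell of
  mixed parity, which is never a hole.\<close>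

lemma double_defect_1:
  assumes v: "valid k k H" and k: "k \<ge> 2" and c: "defect k k H = 1" and n: "n = 2*k-1"
  shows "\<exists>K. valid n n K \<and> defect n n K = 1"
proof -
  let ?o = "\<lambda>(a,b). (2*a+1,2*b+1) :: cell" and ?e = "\<lambda>(a,b). (2*a,2*b) :: cell"
  let ?A = "?o ` ({0..<k-1} \<times> {0..<k-1})"
  define K where "K = ?A \<union> ?e ` H"
  have odd2: "2*u+1 \<noteq> 2*w" "2*u \<noteq> 2*w+1" for u w :: int by presburger+
  have Kee: "(2*a,2*b) \<in> K \<longleftrightarrow> (a,b) \<in> H" and Keo: "(2*a,2*b+1) \<notin> K" and Koe: "(2*a+1,2*b) \<notin> K"
    and Koo: "(2*a+1,2*b+1) \<in> K \<longleftrightarrow> 0 \<le> a \<and> a < k-1 \<and> 0 \<le> b \<and> b < k-1" for a b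
    using odd2 by (auto simp: K_def image_iff Bex_def)
  have parity: "\<exists>a. i = 2*a \<or> i = 2*a+1" for i :: int by (metis evenE oddE)
  let ?S = "grid k k - H" and ?T = "grid n n - K"
  have ST: "(2*a,2*b) \<in> ?T \<longleftrightarrow> (a,b) \<in> ?S" for a b using n by (auto simp: Kee grid_def)
  have mid: "(2*a+1,2*b) \<in> ?T \<longleftrightarrow> (2*a+1,2*b) \<in> grid n n" "(2*a,2*b+1) \<in> ?T \<longleftrightarrow> (2*a,2*b+1) \<in> grid n n" for a b
    using Keo Koe by auto
  have dbl: "linked ?T (0,0) (2 * fst x, 2 * snd x)" if "linked ?S (0,0) x" for x
    using that
  proof (induction rule: rtranclp_induct)
    case (step x y)
    obtain a b where x: "x = (a,b)" by (cases x)
    have st: "(a,b) \<in> ?S" "y \<in> ?S" "nbr (a,b) y" using step(2) by (auto simp: step_def x)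
    have l: "linked ?T (0,0) (2*a,2*b)" using step(3) x by simp
    have two: "linked ?T (0,0) w" if "nbr (2*a,2*b) z" "nbr z w" "z \<in> ?T" "w \<in> ?T" for z w
      using linked_step[OF linked_step[OF l _ that(3,1)] that(3,4,2)] st(1) ST by blast
    from st(3) show ?case
    proof (cases rule: nbr_cases)
      case 1
      show ?thesis by (rule two[of "(2*a+1,2*b)"]) (use 1 st n mid(1)[of a b] ST[of "a+1" b] in \<open>auto simp: nbr_def grid_def\<close>)
    next
      case 2
      show ?thesis by (rule two[of "(2*a-1,2*b)"])
        (use 2 st n mid(1)[of "a-1" b] ST[of "a-1" b] in \<open>auto simp: nbr_def grid_def\<close>)
    next
      case 3
      show ?thesis by (rule two[of "(2*a,2*b+1)"]) (use 3 st n mid(2)[of a b] ST[of a "b+1"] in \<open>auto simp: nbr_def grid_def\<close>)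
    next
      case 4
      show ?thesis by (rule two[of "(2*a,2*b-1)"])
        (use 4 st n mid(2)[of a "b-1"] ST[of a "b-1"] in \<open>auto simp: nbr_def grid_def\<close>)
    qed
  qed simp
  have lkT: "linked ?T (0,0) (2*a,2*b)" if "(a,b) \<in> ?S" for a b
    using dbl[of "(a,b)"] v that by (auto simp: valid_def)
  have "valid n n K"
  proof (rule validI)
    show "K \<subseteq> {1..n-2} \<times> {1..n-2}" using valid_interior[OF v] n by (fastforce simp: K_def)
  next
    fix i j assume h: "(i,j) \<in> K"
    obtain a b where "i = 2*a \<or> i = 2*a+1" "j = 2*b \<or> j = 2*b+1" using parity by meson
    thus "(i+1,j) \<notin> K" "(i,j+1) \<notin> K"
      using h Keo Koe Keo[of "a+1" b] Koe[of a "b+1"] by (auto simp: algebra_simps)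
  next
    fix i j assume T: "(i,j) \<in> ?T"
    obtain a b where "i = 2*a \<or> i = 2*a+1" "j = 2*b \<or> j = 2*b+1" using parity by meson
    then consider "i = 2*a" "j = 2*b" | "i = 2*a+1" "j = 2*b" | "i = 2*a" "j = 2*b+1" | "i = 2*a+1" "j = 2*b+1"
      by blast
    thus "linked ?T (0,0) (i,j)"
    proof cases
      case 1 thus ?thesis using lkT ST T by blast
    next
      case 2
      have g: "(a,b) \<in> grid k k" "(a+1,b) \<in> grid k k" using T 2 n by (auto simp: grid_def)
      have "(a,b) \<in> ?S \<or> (a+1,b) \<in> ?S" using valid_not_nbr[OF v] g by blast
      thus ?thesis
      proof
        assume s: "(a,b) \<in> ?S"
        show ?thesis by (rule linked_step[OF lkT[OF s] _ T]) (use 2 s ST in \<open>auto simp: nbr_def\<close>)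
      next
        assume s: "(a+1,b) \<in> ?S"
        show ?thesis by (rule linked_step[OF lkT[OF s] _ T]) (use 2 s ST[of "a+1" b] in \<open>auto simp: nbr_def\<close>)
      qed
    next
      case 3
      have g: "(a,b) \<in> grid k k" "(a,b+1) \<in> grid k k" using T 3 n by (auto simp: grid_def)
      have "(a,b) \<in> ?S \<or> (a,b+1) \<in> ?S" using valid_not_nbr[OF v] g by blast
      thus ?thesis
      proof
        assume s: "(a,b) \<in> ?S"
        show ?thesis by (rule linked_step[OF lkT[OF s] _ T]) (use 3 s ST in \<open>auto simp: nbr_def\<close>)
      next
        assume s: "(a,b+1) \<in> ?S"
        show ?thesis by (rule linked_step[OF lkT[OF s] _ T]) (use 3 s ST[of a "b+1"] in \<open>auto simp: nbr_def\<close>)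
      qed
    next
      case 4
      hence False using T Koo[of a b] n by (auto simp: grid_def)
      thus ?thesis ..
    qed
  qed
  moreover have "defect n n K = 1"
  proof -
    have "?A \<inter> ?e ` H = {}" using odd2 by auto
    hence "card K = card ?A + card (?e ` H)" unfolding K_def
      using valid_finite[OF v] by (simp add: card_Un_disjoint)
    also have "card ?A = card ({0..<k-1} \<times> {0..<k-1})" by (rule card_image) (auto simp: inj_on_def)
    also have "card (?e ` H) = card H" by (rule card_image) (auto simp: inj_on_def)
    finally have "int (card K) = (k-1)*(k-1) + int (card H)" using k by (simp add: card_cartesian_product)
    thus ?thesis using c unfolding defect_def n by (simp add: algebra_simps)
  qed
  ultimately show ?thesis by blast
qed

lemma exists_defect_1: "\<exists>K. valid (2^l+1) (2^l+1) K \<and> defect (2^l+1) (2^l+1) K = 1"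
proof (induction l)
  case 0
  have "valid 2 2 {}" by (rule validI) (auto simp: grid_def border_def)
  thus ?case by (auto intro!: exI[of _ "{}"] simp: defect_def)
next
  case (Suc l)
  then obtain H where H: "valid (2^l+1) (2^l+1) H" "defect (2^l+1) (2^l+1) H = 1" by blast
  have "(2::int) \<le> 2^l+1" "(2::int)^Suc l + 1 = 2*(2^l+1) - 1" by simp_all
  from double_defect_1[OF H(1) this(1) H(2) this(2)] show ?case .
qed

section \<open>Regions made of tiles\<close>

definition ctr :: "cell \<Rightarrow> real \<times> real" where
  "ctr c = (real_of_int (fst c) + 1/2, real_of_int (snd c) + 1/2)"

definition ocell :: "cell \<Rightarrow> (real \<times> real) set" where
  "ocell c = {real_of_int (fst c) <..< real_of_int (fst c) + 1} \<times> {real_of_int (snd c) <..< real_of_int (snd c) + 1}"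

definition region :: "cell set \<Rightarrow> (real \<times> real) set" where
  "region T = \<Union>(tile ` T)"

lemma ctr_in_ocell: "ctr c \<in> ocell c"
  by (simp add: ctr_def ocell_def)

lemma ocell_subset_tile: "ocell c \<subseteq> tile c"
  by (auto simp: ocell_def tile_def)

lemma open_ocell: "open (ocell c)"
  by (simp add: ocell_def open_Times)

lemma closed_tile: "closed (tile c)"
  by (simp add: tile_def closed_Times)

lemma closure_ocell: "closure (ocell c) = tile c"
  by (simp add: ocell_def tile_def closure_Times)

lemma closed_region: "finite T \<Longrightarrow> closed (region T)"
  unfolding region_def by (intro closed_Union) (auto simp: closed_tile)

lemma of_int_interval_eq:
  assumes "real_of_int i < x" "x < real_of_int i + 1" "real_of_int a \<le> x" "x \<le> real_of_int a + 1"
  shows "a = i"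
proof -
  have "real_of_int i < real_of_int (a + 1)" "real_of_int a < real_of_int (i + 1)" using assms by auto
  thus ?thesis unfolding of_int_less_iff by simp
qed

lemma ocell_tile_eq: "p \<in> ocell c \<Longrightarrow> p \<in> tile d \<Longrightarrow> d = c"
  by (cases p; cases c; cases d)
    (auto simp: ocell_def tile_def intro: of_int_interval_eq)

lemma ocell_region_iff: "p \<in> ocell c \<Longrightarrow> p \<in> region T \<longleftrightarrow> c \<in> T"
  using ocell_tile_eq ocell_subset_tile unfolding region_def by blast

lemma ctr_region_iff: "ctr c \<in> region T \<longleftrightarrow> c \<in> T"
  by (rule ocell_region_iff[OF ctr_in_ocell])

text \<open>Lets a point move to the centre of its cell without leaving the region or its
  complement, so that connectivity need only be examined at centres.\<close>

lemma tile_segment_ctr: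
  assumes p: "p \<in> tile c" and q: "q \<in> closed_segment p (ctr c)"
  shows "q = p \<or> q \<in> ocell c"
proof -
  obtain x y where p': "p = (x,y)" by (cases p)
  obtain i j where c: "c = (i,j)" by (cases c)
  obtain t where t: "0 \<le> t" "t \<le> 1" "q = (1-t) *\<^sub>R p + t *\<^sub>R ctr c"
    using q by (auto simp: in_segment)
  show ?thesis
  proof (cases "t = 0")
    case True thus ?thesis using t by simp
  next
    case False
    have between: "a < (1-t)*z + t*(a+1/2) \<and> (1-t)*z + t*(a+1/2) < a+1" if "a \<le> z" "z \<le> a+1" for a z :: real
    proof -
      have "(1-t)*a \<le> (1-t)*z" "(1-t)*z \<le> (1-t)*(a+1)" using that t by (auto intro: mult_left_mono)
      thus ?thesis using False t by (simp add: algebra_simps)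
    qed
    have "real_of_int i \<le> x" "x \<le> real_of_int i + 1" "real_of_int j \<le> y" "y \<le> real_of_int j + 1"
      using p by (auto simp: p' c tile_def)
    thus ?thesis using between[of "real_of_int i" x] between[of "real_of_int j" y] t(3)
      by (simp add: p' c ocell_def ctr_def)
  qed
qed

text \<open>\<open>R\<close> is the open rectangle formed by the two tiles. It lies in the region if
  both are present, and its points on the segment meet no tile if both are missing.\<close>

lemma nbr_segment:
  assumes "nbr c d"
  shows "\<exists>R. open R \<and> closed_segment (ctr c) (ctr d) \<subseteq> R \<and> R \<subseteq> tile c \<union> tile d
    \<and> (\<forall>p\<in>R. \<forall>e. p \<in> tile e \<and> p \<in> closed_segment (ctr c) (ctr d) \<longrightarrow> e = c \<or> e = d)"
proof -
  have half: "a = j" if "real_of_int a \<le> real_of_int j + 1/2" "real_of_int j + 1/2 \<le> real_of_int a + 1" for a j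
    by (rule of_int_interval_eq[of j "real_of_int j + 1/2"]) (use that in auto)
  have two: "a = i \<or> a = i+1" if "real_of_int i < x" "x < real_of_int i + 2" "real_of_int a \<le> x" "x \<le> real_of_int a + 1"
    for a i x
  proof -
    have "real_of_int i < real_of_int (a + 1)" "real_of_int a < real_of_int (i + 2)" using that by auto
    thus ?thesis unfolding of_int_less_iff by arith
  qed
  let ?Q = "\<lambda>c d. \<exists>R. open R \<and> closed_segment (ctr c) (ctr d) \<subseteq> R \<and> R \<subseteq> tile c \<union> tile d
    \<and> (\<forall>p\<in>R. \<forall>e. p \<in> tile e \<and> p \<in> closed_segment (ctr c) (ctr d) \<longrightarrow> e = c \<or> e = d)"
  have H: "?Q (i,j) (i+1,j)" for i j
  proof -
    let ?R = "{real_of_int i <..< real_of_int i + 2} \<times> {real_of_int j <..< real_of_int j + 1}"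
    have seg: "closed_segment (ctr (i,j)) (ctr (i+1,j)) \<subseteq> ?R"
      by (rule closed_segment_subset) (auto simp: ctr_def intro!: convex_Times)
    have y: "snd p = real_of_int j + 1/2" if "p \<in> closed_segment (ctr (i,j)) (ctr (i+1,j))" for p
      using that by (auto simp: in_segment ctr_def field_simps)
    have "e = (i,j) \<or> e = (i+1,j)" if "p \<in> ?R" "p \<in> tile e" "p \<in> closed_segment (ctr (i,j)) (ctr (i+1,j))" for p e
      using two[of i "fst p" "fst e"] half[of "snd e" j] y[OF that(3)] that(1,2)
      by (cases p; cases e) (auto simp: tile_def)
    moreover have "?R \<subseteq> tile (i,j) \<union> tile (i+1,j)" by (auto simp: tile_def)
    ultimately show ?thesis using seg by (intro exI[of _ ?R]) (auto simp: open_Times)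
  qed
  have V: "?Q (i,j) (i,j+1)" for i j
  proof -
    let ?R = "{real_of_int i <..< real_of_int i + 1} \<times> {real_of_int j <..< real_of_int j + 2}"
    have seg: "closed_segment (ctr (i,j)) (ctr (i,j+1)) \<subseteq> ?R"
      by (rule closed_segment_subset) (auto simp: ctr_def intro!: convex_Times)
    have x: "fst p = real_of_int i + 1/2" if "p \<in> closed_segment (ctr (i,j)) (ctr (i,j+1))" for p
      using that by (auto simp: in_segment ctr_def field_simps)
    have "e = (i,j) \<or> e = (i,j+1)" if "p \<in> ?R" "p \<in> tile e" "p \<in> closed_segment (ctr (i,j)) (ctr (i,j+1))" for p e
      using two[of j "snd p" "snd e"] half[of "fst e" i] x[OF that(3)] that(1,2)
      by (cases p; cases e) (auto simp: tile_def)
    moreover have "?R \<subseteq> tile (i,j) \<union> tile (i,j+1)" by (auto simp: tile_def)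
    ultimately show ?thesis using seg by (intro exI[of _ ?R]) (auto simp: open_Times)
  qed
  have sw: "?Q c d" if "?Q d c" for c d
    using that unfolding closed_segment_commute[of "ctr d" "ctr c"] Un_commute[of "tile d" "tile c"]
    by (simp add: disj_commute)
  obtain i j where c: "c = (i,j)" by (cases c)
  from assms[unfolded c] show ?thesis unfolding c
  proof (cases rule: nbr_cases)
    case 1 from H[of i j] show "?Q (i,j) d" unfolding 1 .
  next
    case 2 from sw[OF H[of "i-1" j, unfolded diff_add_cancel]] show "?Q (i,j) d" unfolding 2 .
  next
    case 3 from V[of i j] show "?Q (i,j) d" unfolding 3 .
  next
    case 4 from sw[OF V[of i "j-1", unfolded diff_add_cancel]] show "?Q (i,j) d" unfolding 4 .
  qed
qed

lemma nbr_segment_subset: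
  assumes "nbr c d"
  shows "c \<in> T \<Longrightarrow> d \<in> T \<Longrightarrow> closed_segment (ctr c) (ctr d) \<subseteq> interior (region T)"
    and "c \<notin> T \<Longrightarrow> d \<notin> T \<Longrightarrow> closed_segment (ctr c) (ctr d) \<subseteq> - region T"
proof -
  obtain R where R: "open R" "closed_segment (ctr c) (ctr d) \<subseteq> R" "R \<subseteq> tile c \<union> tile d"
    "\<And>p e. p \<in> R \<Longrightarrow> p \<in> tile e \<Longrightarrow> p \<in> closed_segment (ctr c) (ctr d) \<Longrightarrow> e = c \<or> e = d"
    using nbr_segment[OF assms] by blast
  show "closed_segment (ctr c) (ctr d) \<subseteq> interior (region T)" if "c \<in> T" "d \<in> T"
  proof -
    have "R \<subseteq> region T" using R(3) that by (auto simp: region_def)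
    thus ?thesis using R(1,2) interior_maximal by blast
  qed
  show "closed_segment (ctr c) (ctr d) \<subseteq> - region T" if "c \<notin> T" "d \<notin> T"
    using R(2,4) that unfolding region_def by blast
qed

lemma ocell_subset_interior: "c \<in> T \<Longrightarrow> ocell c \<subseteq> interior (region T)"
  by (rule interior_maximal[OF _ open_ocell]) (use ocell_subset_tile region_def in fast)

text \<open>\<open>tile c\<close> is the closure of \<open>ocell c\<close>, so a neighbourhood of
  \<open>p\<close> contains points that no tile but \<open>c\<close> covers.\<close>

lemma interior_region_cells:
  assumes "p \<in> interior (region T)" "p \<in> tile c"
  shows "c \<in> T"
proof -
  have "interior (region T) \<inter> closure (ocell c) \<noteq> {}" using assms by (auto simp: closure_ocell)
  hence "interior (region T) \<inter> ocell c \<noteq> {}" using open_Int_closure_eq_empty[OF open_interior] by blast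
  then obtain q where "q \<in> interior (region T)" "q \<in> ocell c" by blast
  thus ?thesis using interior_subset ocell_region_iff by blast
qed

lemma segment_connected_component:
  fixes p q :: "'a :: real_normed_vector"
  shows "closed_segment p q \<subseteq> S \<Longrightarrow> connected_component S p q"
  by (auto simp: connected_component_def convex_connected intro!: exI[of _ "closed_segment p q"])

lemma connected_interior_region:
  assumes "\<And>x. x \<in> T \<Longrightarrow> linked T s x"
  shows "connected (interior (region T))"
proof -
  let ?I = "interior (region T)"
  have c: "linked T s x \<Longrightarrow> s \<in> T \<Longrightarrow> connected_component ?I (ctr s) (ctr x)" for x
  proof (induction rule: rtranclp_induct)
    case base
    hence "ctr s \<in> ?I" using ocell_subset_interior ctr_in_ocell by blast
    thus ?case by simp
  next
    case (step y z)
    have "connected_component ?I (ctr y) (ctr z)"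
      by (rule segment_connected_component, rule nbr_segment_subset) (use step(2) in \<open>auto simp: step_def\<close>)
    thus ?case using step connected_component_trans by blast
  qed
  have "connected_component ?I (ctr s) p" if p: "p \<in> ?I" for p
  proof -
    obtain x where x: "x \<in> T" "p \<in> tile x" using p interior_subset unfolding region_def by blast
    have "s \<in> T" using assms[OF x(1)] x(1) by (cases rule: converse_rtranclpE) (auto simp: step_def)
    hence "connected_component ?I (ctr s) (ctr x)" using c assms x by blast
    moreover have "closed_segment p (ctr x) \<subseteq> ?I"
      using tile_segment_ctr[OF x(2)] p ocell_subset_interior[OF x(1)] by blast
    ultimately show ?thesis
      using segment_connected_component connected_component_sym connected_component_trans by metis
  qed
  thus ?thesis unfolding connected_iff_connected_component
    using connected_component_sym connected_component_trans by metis
qed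

text \<open>If some cells are not linked to \<open>x\<close>, the tiles linked to \<open>x\<close>
  and the remaining ones give two closed sets covering the interior; they would separate it.\<close>

lemma connected_interior_linked:
  assumes fin: "finite T" and con: "connected (interior (region T))" and x: "x \<in> T" and y: "y \<in> T"
  shows "linked T x y"
proof (rule ccontr)
  assume nl: "\<not> linked T x y"
  define A where "A = {z \<in> T. linked T x z}"
  let ?I = "interior (region T)"
  have AT: "A \<subseteq> T" by (auto simp: A_def)
  have "?I \<subseteq> region A \<union> region (T - A)" using interior_subset[of "region T"] unfolding region_def A_def by blast
  moreover have "region A \<inter> region (T - A) \<inter> ?I = {}"
  proof (rule ccontr)
    assume "region A \<inter> region (T - A) \<inter> ?I \<noteq> {}"
    then obtain p u v where p: "p \<in> ?I" "u \<in> A" "v \<in> T - A" "p \<in> tile u" "p \<in> tile v"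
      unfolding region_def[of A] region_def[of "T - A"] by blast
    obtain i j a b where uv: "u = (i,j)" "v = (a,b)" by (cases u; cases v)
    \<comment> \<open>If \<open>u\<close> and \<open>v\<close> touch only at a corner, the interior
      point \<open>p\<close> also lies in the tile \<open>(i,b)\<close>, which is then present and
      links them.\<close>
    have w: "p \<in> tile (i,b)" using p(4,5) by (cases p) (auto simp: tile_def uv)
    have "real_of_int i \<le> real_of_int (a+1)" "real_of_int a \<le> real_of_int (i+1)"
      "real_of_int j \<le> real_of_int (b+1)" "real_of_int b \<le> real_of_int (j+1)"
      using p(4,5) by (auto simp: tile_def uv)
    hence near: "\<bar>i-a\<bar> \<le> 1" "\<bar>j-b\<bar> \<le> 1" unfolding of_int_le_iff by auto
    have T: "u \<in> T" "(i,b) \<in> T" "v \<in> T" using interior_region_cells[OF p(1)] p(4,5) w by blast+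
    have "u = (i,b) \<or> nbr u (i,b)" "(i,b) = v \<or> nbr (i,b) v" using near by (auto simp: uv nbr_def)
    hence "linked T u v" using linked_nbr[OF T(1,2)] linked_nbr[OF T(2,3)] linked_trans by blast
    hence "v \<in> A" using p(2) T(3) linked_trans by (auto simp: A_def)
    thus False using p(3) by simp
  qed
  moreover have "closed (region A)" "closed (region (T - A))"
    using fin AT by (auto intro!: closed_region intro: finite_subset)
  ultimately have "region A \<inter> ?I = {} \<or> region (T - A) \<inter> ?I = {}" by (intro connected_closedD[OF con]) auto
  moreover have "ctr x \<in> region A \<inter> ?I" "ctr y \<in> region (T - A) \<inter> ?I"
    using x y nl ocell_subset_interior ctr_in_ocell unfolding ctr_region_iff Int_iff A_def by blast+
  ultimately show False by blast
qed

section \<open>Holes of polyominoes\<close>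

lemma polyominoE:
  assumes "polyomino P"
  obtains T where "finite T" "T \<noteq> {}" "P = region T" "\<And>x y. x \<in> T \<Longrightarrow> y \<in> T \<Longrightarrow> linked T x y"
proof -
  obtain T where T: "finite T" "T \<noteq> {}" "P = region T" "connected (interior P)"
    using assms unfolding polyomino_def region_def by blast
  show thesis by (rule that[OF T(1-3)]) (use T connected_interior_linked in blast)
qed

lemma region_subset_rectangle:
  "region T \<subseteq> {0..real n} \<times> {0..real m} \<longleftrightarrow> T \<subseteq> grid (int n) (int m)"
proof
  assume s: "region T \<subseteq> {0..real n} \<times> {0..real m}"
  show "T \<subseteq> grid (int n) (int m)"
  proof (rule subrelI)
    fix i j assume "(i,j) \<in> T"
    hence "tile (i,j) \<subseteq> {0..real n} \<times> {0..real m}" using s by (auto simp: region_def)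
    moreover have "(real_of_int i, real_of_int j) \<in> tile (i,j)" "(real_of_int i + 1, real_of_int j + 1) \<in> tile (i,j)"
      by (auto simp: tile_def)
    ultimately have "(real_of_int i, real_of_int j) \<in> {0..real n} \<times> {0..real m}"
      "(real_of_int i + 1, real_of_int j + 1) \<in> {0..real n} \<times> {0..real m}" by blast+
    hence "real_of_int 0 \<le> real_of_int i" "real_of_int (i+1) \<le> real_of_int (int n)"
      "real_of_int 0 \<le> real_of_int j" "real_of_int (j+1) \<le> real_of_int (int m)" by auto
    thus "(i,j) \<in> grid (int n) (int m)" unfolding of_int_le_iff by (auto simp: grid_def)
  qed
next
  assume s: "T \<subseteq> grid (int n) (int m)"
  have "tile (i,j) \<subseteq> {0..real n} \<times> {0..real m}" if "(i,j) \<in> T" for i j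
  proof -
    have "0 \<le> i" "i + 1 \<le> int n" "0 \<le> j" "j + 1 \<le> int m" using that s by (auto simp: grid_def)
    hence "real_of_int 0 \<le> real_of_int i" "real_of_int (i+1) \<le> real_of_int (int n)"
      "real_of_int 0 \<le> real_of_int j" "real_of_int (j+1) \<le> real_of_int (int m)"
      unfolding of_int_le_iff by auto
    thus ?thesis by (auto simp: tile_def)
  qed
  thus "region T \<subseteq> {0..real n} \<times> {0..real m}" by (force simp: region_def)
qed

section \<open>From a polyomino to a configuration of holes\<close>

abbreviation outer :: "cell set \<Rightarrow> cell \<Rightarrow> (real \<times> real) set" where
  "outer T c \<equiv> connected_component_set (- region T) (ctr c)"

lemma outer_nbr:
  assumes "nbr c d" "c \<notin> T" "d \<notin> T"
  shows "outer T c = outer T d"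
  using segment_connected_component[OF nbr_segment_subset(2)[OF assms]]
  by (simp add: connected_component_eq_eq ctr_region_iff assms)

lemma components_outer:
  assumes "C \<in> components (- region T)"
  shows "\<exists>c. c \<notin> T \<and> C = outer T c"
proof -
  obtain x y where p: "(x,y) \<notin> region T" "C = connected_component_set (- region T) (x,y)"
    using assms by (auto simp: components_def)
  define c where "c = (\<lfloor>x\<rfloor>, \<lfloor>y\<rfloor>)"
  have t: "(x,y) \<in> tile c" by (simp add: tile_def c_def)
  hence c: "c \<notin> T" using p(1) by (auto simp: region_def)
  have "closed_segment (x,y) (ctr c) \<subseteq> - region T"
    using tile_segment_ctr[OF t] p(1) c ocell_region_iff by blast
  hence "connected_component (- region T) (x,y) (ctr c)" by (rule segment_connected_component)
  hence "C = outer T c" using p(2) connected_component_eq by fastforce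
  thus ?thesis using c by blast
qed

lemma ctr_in_outer: "c \<notin> T \<Longrightarrow> ctr c \<in> outer T c"
  by (simp add: ctr_region_iff)

text \<open>Otherwise the centres along the whole ray belong to one component, which is then
  unbounded.\<close>

lemma bounded_outer_ray:
  assumes b: "bounded (outer T (i,j))" and n: "(i,j) \<notin> T" and u: "nbr (0,0) (u,v)"
  shows "\<exists>k::nat. k \<ge> 1 \<and> (i + int k * u, j + int k * v) \<in> T"
proof (rule ccontr)
  assume a: "\<not> ?thesis"
  have nT: "(i + int k * u, j + int k * v) \<notin> T" for k
    using a n by (cases k) auto
  have "outer T (i + int k * u, j + int k * v) = outer T (i,j)" for k
  proof (induction k)
    case (Suc k)
    have "nbr (i + int k * u, j + int k * v) (i + int (Suc k) * u, j + int (Suc k) * v)"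
      using u by (auto simp: nbr_def algebra_simps)
    thus ?case using outer_nbr nT Suc by metis
  qed simp
  hence inC: "ctr (i + int k * u, j + int k * v) \<in> outer T (i,j)" for k
    using ctr_in_outer[OF nT] by metis
  obtain B where B: "\<And>p. p \<in> outer T (i,j) \<Longrightarrow> norm p \<le> B" using b by (auto simp: bounded_iff)
  obtain k :: nat where k: "real k > B + \<bar>real_of_int i\<bar> + \<bar>real_of_int j\<bar> + 1" using reals_Archimedean2 by blast
  define p where "p = ctr (i + int k * u, j + int k * v)"
  have "\<bar>fst p\<bar> \<le> B" "\<bar>snd p\<bar> \<le> B"
    using B[OF inC[of k], folded p_def] norm_fst_le[of "fst p" "snd p"] norm_snd_le[of "snd p" "fst p"] by auto
  hence f: "\<bar>real_of_int i + real k * real_of_int u + 1/2\<bar> \<le> B" "\<bar>real_of_int j + real k * real_of_int v + 1/2\<bar> \<le> B"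
    by (simp_all add: p_def ctr_def)
  have "(u,v) = (0+1,0) \<or> (u,v) = (0-1,0) \<or> (u,v) = (0,0+1) \<or> (u,v) = (0,0-1)" using u by (cases rule: nbr_cases) auto
  thus False using f k by (elim disjE) auto
qed

text \<open>A straight walk stays in one component of the complement until it meets a tile or the
  border, so only a chosen cell of that same component could block it, and \<open>free\<close>
  excludes this.\<close>

lemma linked_up_to_tile:
  assumes S: "\<And>x. x \<in> T0 \<Longrightarrow> x \<in> S" and S_def: "S = grid n m - H"
    and x: "(i,j) \<in> S" and e: "\<bar>e\<bar> = 1"
    and free: "\<And>k::nat. (i + e * int k, j) \<in> H \<Longrightarrow> outer T0 (i + e * int k, j) = outer T0 (i,j) \<Longrightarrow> False"
  shows "\<exists>y \<in> T0 \<union> border n m. y \<in> S \<and> linked S (i,j) y"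
proof (rule ccontr)
  assume neg: "\<not> ?thesis"
  have "linked S (i,j) (i + e * int k, j) \<and> (i + e * int k, j) \<in> S \<and> outer T0 (i + e * int k, j) = outer T0 (i,j)" for k
  proof (induction k)
    case 0 thus ?case using x by simp
  next
    case (Suc k)
    let ?z = "(i + e * int k, j)" and ?y = "(i + e * int (Suc k), j)"
    have nb: "nbr ?z ?y" using e by (auto simp: nbr_def algebra_simps)
    have z: "?z \<notin> border n m" "?z \<notin> T0" "?z \<in> S" "linked S (i,j) ?z" using neg Suc by blast+
    have "?z \<in> grid n m" using z(3) S_def by blast
    hence g: "?y \<in> grid n m" using z(1) e by (auto simp: border_def grid_def algebra_simps)
    have nT: "?y \<notin> T0"
    proof
      assume y: "?y \<in> T0"
      have "linked S (i,j) ?y" by (rule linked_step[OF z(4,3) S[OF y] nb])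
      thus False using neg y S[OF y] by blast
    qed
    have o: "outer T0 ?y = outer T0 (i,j)" using outer_nbr[OF nb z(2) nT] Suc by simp
    have "?y \<in> S" using g free[of "Suc k"] o S_def by blast
    thus ?case using linked_step[OF z(4,3) _ nb] o by blast
  qed
  from this[of "nat n"] have "(i + e * int (nat n), j) \<in> grid n m" "(i,j) \<in> grid n m" using S_def x by blast+
  moreover have "e = 1 \<or> e = -1" using e by arith
  ultimately show False by (auto simp: grid_def)
qed

lemma polyomino_holes:
  assumes P: "polyomino P" and sub: "P \<subseteq> {0..real n} \<times> {0..real m}"
  shows "finite {C \<in> components (- P). bounded C} \<and> (\<exists>H. valid (int n) (int m) H \<and> card H = num_holes P)"
proof -
  obtain T0 where T0: "finite T0" "T0 \<noteq> {}" "P = region T0" and lk: "\<And>x y. x \<in> T0 \<Longrightarrow> y \<in> T0 \<Longrightarrow> linked T0 x y"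
    using polyominoE[OF P] by metis
  let ?n = "int n" and ?m = "int m"
  have T0g: "T0 \<subseteq> grid ?n ?m" using sub region_subset_rectangle T0(3) by blast
  define BC where "BC = {C \<in> components (- P). bounded C}"
  define rep where "rep C = (SOME c. c \<notin> T0 \<and> C = outer T0 c)" for C
  have rep: "rep C \<notin> T0 \<and> C = outer T0 (rep C)" if "C \<in> BC" for C
  proof -
    have "\<exists>c. c \<notin> T0 \<and> C = outer T0 c" using that components_outer unfolding BC_def T0(3) by blast
    thus ?thesis unfolding rep_def by (rule someI_ex)
  qed
  define H where "H = rep ` BC"
  have inj: "inj_on rep BC" by (rule inj_onI) (metis rep)
  have Hb: "c \<notin> T0" "bounded (outer T0 c)" "outer T0 c \<in> BC" "rep (outer T0 c) = c" if h: "c \<in> H" for c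
  proof -
    obtain C where C: "C \<in> BC" "c = rep C" using h unfolding H_def by blast
    have "C = outer T0 c" using rep[OF C(1)] C(2) by blast
    thus "c \<notin> T0" "bounded (outer T0 c)" "outer T0 c \<in> BC" "rep (outer T0 c) = c"
      using C rep[OF C(1)] by (auto simp: BC_def)
  qed
  have uniq: "c = d" if "c \<in> H" "d \<in> H" "outer T0 c = outer T0 d" for c d
    using Hb(4)[OF that(1)] Hb(4)[OF that(2)] that(3) by metis
  have ray: "\<exists>k::nat. k \<ge> 1 \<and> (i + int k * u, j + int k * v) \<in> grid ?n ?m" if "(i,j) \<in> H" "nbr (0,0) (u,v)" for i j u v
    using bounded_outer_ray[OF Hb(2,1)[OF that(1)] that(2)] T0g by blast
  \<comment> \<open>A bounded component has tiles in all four directions from its representative,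
    which is therefore not on the border.\<close>
  have Hint: "H \<subseteq> {1..?n-2} \<times> {1..?m-2}"
  proof (rule subrelI)
    fix i j assume h: "(i,j) \<in> H"
    show "(i,j) \<in> {1..?n-2} \<times> {1..?m-2}"
      using ray[OF h, of 1 0] ray[OF h, of "-1" 0] ray[OF h, of 0 1] ray[OF h, of 0 "-1"]
      by (auto simp: nbr_def grid_def)
  qed
  have finH: "finite H" using Hint by (rule finite_subset) auto
  have finBC: "finite BC" using finite_imageD[OF _ inj] finH unfolding H_def by blast
  have card: "card H = num_holes P" unfolding H_def using card_image[OF inj] by (simp add: num_holes_def BC_def)
  let ?S = "grid ?n ?m - H"
  have T0S: "x \<in> ?S" if "x \<in> T0" for x using that T0g Hb(1) by blast
  have bd: "linked ?S (0,0) x" if "x \<in> border ?n ?m" for x using border_linked[OF Hint that] .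
  have T0l: "linked ?S x y" if "x \<in> T0" "y \<in> T0" for x y
    by (rule linked_mono[OF lk[OF that]]) (use T0S in blast)
  \<comment> \<open>A tile of least first coordinate: a representative to its left would need a tile
    still further left, so the way from \<open>a\<close> to the border is free.\<close>
  obtain a where a: "a \<in> T0" "\<And>b. b \<in> T0 \<Longrightarrow> fst a \<le> fst b"
    using arg_min_if_finite(1)[OF T0(1,2), of fst] arg_min_least[OF T0(1,2), of _ fst] by blast
  have a0: "linked ?S (0,0) a"
  proof -
    obtain i j where ij: "a = (i,j)" by (cases a)
    have g: "0 \<le> i" "i < ?n" "0 \<le> j" "j < ?m" using a(1) T0g by (auto simp: ij grid_def)
    have "(k,j) \<in> ?S" if k: "0 \<le> k" "k \<le> i" for k
    proof -
      have "(k,j) \<notin> H"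
      proof
        assume h: "(k,j) \<in> H"
        obtain l :: nat where "l \<ge> 1" "(k + int l * (-1), j + int l * 0) \<in> T0"
          using bounded_outer_ray[OF Hb(2,1)[OF h], of "-1" 0] by (auto simp: nbr_def)
        thus False using a(2) k by (force simp: ij)
      qed
      thus ?thesis using k g by (auto simp: grid_def)
    qed
    hence "linked ?S (0,j) (i,j)" using g by (intro linked_col) auto
    moreover have "(0,j) \<in> border ?n ?m" using g by (auto simp: border_def grid_def)
    ultimately show ?thesis unfolding ij using bd linked_trans by blast
  qed
  have goal: "linked ?S (0,0) y" if "y \<in> T0 \<union> border ?n ?m" for y
    using that bd linked_trans[OF a0 T0l[OF a(1)]] by blast
  have "linked ?S (0,0) (i,j)" if x: "(i,j) \<in> ?S" for i j
  proof -
    \<comment> \<open>A component has a single representative, which can obstruct only one of the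
      two opposite directions.\<close>
    have "\<exists>e::int. \<bar>e\<bar> = 1 \<and> (\<forall>k::nat. (i + e * int k, j) \<in> H \<longrightarrow> outer T0 (i + e * int k, j) \<noteq> outer T0 (i,j))"
    proof (rule ccontr)
      assume neg: "\<not> ?thesis"
      have up: "\<exists>k::nat. (i + e * int k, j) \<in> H \<and> outer T0 (i + e * int k, j) = outer T0 (i,j)" if "\<bar>e\<bar> = 1" for e
        using neg that by blast
      obtain k l :: nat where k: "(i + 1 * int k, j) \<in> H" "outer T0 (i + 1 * int k, j) = outer T0 (i,j)"
        and l: "(i + (-1) * int l, j) \<in> H" "outer T0 (i + (-1) * int l, j) = outer T0 (i,j)"
        using up[of 1] up[of "-1"] by auto
      have "(i + 1 * int k, j) = (i + (-1) * int l, j)" by (rule uniq) (use k l in simp_all)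
      hence "k = 0" by simp
      thus False using k(1) x by simp
    qed
    then obtain e :: int where e: "\<bar>e\<bar> = 1"
      "\<And>k::nat. (i + e * int k, j) \<in> H \<Longrightarrow> outer T0 (i + e * int k, j) \<noteq> outer T0 (i,j)" by blast
    obtain y where y: "y \<in> T0 \<union> border ?n ?m" "linked ?S (i,j) y"
      using linked_up_to_tile[OF T0S refl x e(1)] e(2) by blast
    show ?thesis by (rule linked_trans[OF goal[OF y(1)] linked_sym[OF y(2)]])
  qed
  moreover have "\<not> nbr x y" if "x \<in> H" "y \<in> H" for x y
  proof
    assume nb: "nbr x y"
    hence "x = y" using uniq[OF that] outer_nbr Hb(1) that by blast
    thus False using nb by (simp add: nbr_def)
  qed
  ultimately have "valid ?n ?m H" using Hint unfolding valid_def by auto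
  thus ?thesis using card finBC unfolding BC_def by blast
qed

section \<open>From a configuration to a polyomino\<close>

lemma valid_polyomino:
  assumes v: "valid (int n) (int m) H" and o: "n \<ge> 1" "m \<ge> 1"
  shows "\<exists>P. polyomino P \<and> P \<subseteq> {0..real n} \<times> {0..real m} \<and> card H \<le> num_holes P"
proof -
  let ?T = "grid (int n) (int m) - H"
  define P where "P = region ?T"
  have "(0,0) \<in> ?T" using o valid_interior[OF v, of 0 0] by (auto simp: grid_def)
  moreover have "connected (interior P)" unfolding P_def
    by (rule connected_interior_region[of _ "(0,0)"]) (use v in \<open>auto simp: valid_def\<close>)
  ultimately have P: "polyomino P" unfolding polyomino_def P_def region_def
    by (intro conjI exI[of _ ?T]) auto
  have sub: "P \<subseteq> {0..real n} \<times> {0..real m}" unfolding P_def region_subset_rectangle by blast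
  have inside: "outer ?T h \<subseteq> ocell h" if h: "h \<in> H" for h
  proof -
    obtain i j where ij: "h = (i,j)" by (cases h)
    have nbT: "(i+1,j) \<in> ?T" "(i-1,j) \<in> ?T" "(i,j+1) \<in> ?T" "(i,j-1) \<in> ?T"
      using valid_interior[OF v h[unfolded ij]] valid_not_nbr[OF v h[unfolded ij]] by (auto simp: grid_def)
    \<comment> \<open>The frame of \<open>h\<close> is covered by the four neighbouring tiles, so
      the component of its centre cannot cross it.\<close>
    have "tile h - ocell h \<subseteq> tile (i+1,j) \<union> tile (i-1,j) \<union> tile (i,j+1) \<union> tile (i,j-1)"
      by (auto simp: tile_def ocell_def ij)
    also have "\<dots> \<subseteq> region ?T" using nbT unfolding region_def by blast
    finally have "outer ?T h \<subseteq> ocell h \<union> - tile h" using connected_component_subset by blast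
    hence "ocell h \<inter> outer ?T h = {} \<or> - tile h \<inter> outer ?T h = {}"
      using ocell_subset_tile[of h]
      by (intro connectedD[OF connected_connected_component]) (auto simp: open_ocell closed_tile simp del: split_paired_All)
    moreover have "ctr h \<in> ocell h \<inter> outer ?T h" using ctr_in_ocell ctr_in_outer h by blast
    ultimately show ?thesis using \<open>outer ?T h \<subseteq> ocell h \<union> - tile h\<close> by blast
  qed
  have "inj_on (outer ?T) H"
  proof (rule inj_onI)
    fix x y assume xy: "x \<in> H" "y \<in> H" "outer ?T x = outer ?T y"
    have "ctr x \<in> ocell y" using ctr_in_outer[of x ?T] inside[OF xy(2)] xy by blast
    thus "x = y" using ocell_tile_eq ocell_subset_tile ctr_in_ocell by blast
  qed
  hence "card H = card (outer ?T ` H)" by (simp add: card_image)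
  also have "\<dots> \<le> card {C \<in> components (- P). bounded C}"
  proof (rule card_mono)
    show "finite {C \<in> components (- P). bounded C}" using polyomino_holes[OF P sub] by blast
    show "outer ?T ` H \<subseteq> {C \<in> components (- P). bounded C}"
    proof (rule image_subsetI)
      fix h assume h: "h \<in> H"
      have "bounded (outer ?T h)"
        by (rule bounded_subset[OF _ inside[OF h]]) (simp add: ocell_def bounded_Times)
      moreover have "ctr h \<in> - P" using h by (simp add: P_def ctr_region_iff)
      ultimately show "outer ?T h \<in> {C \<in> components (- P). bounded C}" by (simp add: P_def componentsI)
    qed
  qed
  finally show ?thesis using P sub by (auto simp: num_holes_def)
qed

lemma hmax_eqI:
  assumes o: "n \<ge> 1" "m \<ge> 1" and v: "valid (int n) (int m) H"
    and max: "\<And>K. valid (int n) (int m) K \<Longrightarrow> card K \<le> card H"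
  shows "hmax n m = card H"
  unfolding hmax_def
proof (rule Max_eqI)
  let ?A = "{num_holes P |P. polyomino P \<and> P \<subseteq> {0..real n} \<times> {0..real m}}"
  have le: "y \<le> card H" if "y \<in> ?A" for y
    using that polyomino_holes max by fastforce
  show "finite ?A" by (rule finite_subset[of _ "{..card H}"]) (use le in auto)
  show "y \<le> card H" if "y \<in> ?A" for y using le that .
  obtain P where P: "polyomino P" "P \<subseteq> {0..real n} \<times> {0..real m}" "card H \<le> num_holes P"
    using valid_polyomino[OF v o] by blast
  hence "num_holes P \<in> ?A" by blast
  with le[OF this] P(3) show "card H \<in> ?A" by simp
qed

section \<open>The values of \<open>hmax\<close>\<close>

lemma hmax_defect:
  assumes o: "n \<ge> 1" "m \<ge> 1" and v: "valid (int n) (int m) H"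
    and min: "\<And>K. valid (int n) (int m) K \<Longrightarrow> defect (int n) (int m) H \<le> defect (int n) (int m) K"
  shows "real (hmax n m) = ((real n - 1) * (real m - 1) - real_of_int (defect (int n) (int m) H)) / 3"
proof -
  have "hmax n m = card H"
    by (rule hmax_eqI[OF o v]) (use min in \<open>force simp: defect_def\<close>)
  thus ?thesis by (simp add: defect_def)
qed

lemma defect_mod_3: "defect n m H mod 3 = (n-1) * (m-1) mod 3"
  unfolding defect_def by (metis mod_mult_self2 diff_add_cancel)

lemma even_cases_mod_6:
  assumes "even (n::int)" "n \<ge> 4"
  obtains k where "n = 4 + 6 * int k" | k where "n = 6 + 6 * int k" | k where "n = 8 + 6 * int k"
proof -
  define k where "k = nat ((n - 4) div 6)"
  have "n = 4 + 6 * int k \<or> n = 6 + 6 * int k \<or> n = 8 + 6 * int k"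
  proof -
    have "int k = (n - 4) div 6" using assms by (simp add: k_def)
    thus ?thesis using assms by presburger
  qed
  thus thesis using that by blast
qed

lemma attainable_even_square:
  assumes "even n" "n \<ge> 4"
  shows "attainable n n (if n mod 3 = 1 then 3 else 4)"
  using assms
proof (cases rule: even_cases_mod_6)
  case (1 k)
  have "n mod 3 = 1" unfolding 1 by presburger
  thus ?thesis using attainable_extend_6_6[OF attainable_4_4, of k k] 1 by simp
next
  case (2 k)
  have "n mod 3 \<noteq> 1" unfolding 2 by presburger
  thus ?thesis using attainable_extend_6_6[OF attainable_6_6, of k k] 2 by simp
next
  case (3 k)
  have "n mod 3 \<noteq> 1" unfolding 3 by presburger
  thus ?thesis using attainable_extend_6_6[OF attainable_8_8, of k k] 3 by simp
qed

text \<open>For odd \<open>n\<close> the even square of side \<open>n - 3\<close> is extended once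
  in each direction; nothing is to be reserved after the second extension, so its odd row length is
  harmless. This requires \<open>n - 3\<close> to be at least 4, hence the exceptions.\<close>

lemma square_attained:
  assumes n: "n \<ge> 3" "n \<noteq> 3" "n \<noteq> 5"
  shows "\<exists>H. valid n n H \<and> defect n n H = (if n mod 3 = 1 then 3 else 4)"
proof (cases "even n")
  case True
  thus ?thesis using attainable_even_square[of n] n by (auto simp: attainable_def)
next
  case False
  define k where "k = n - 3"
  have k: "even k" "k \<ge> 4" "n = k + 3" using False n unfolding k_def by presburger+
  have m: "n mod 3 = 1 \<longleftrightarrow> k mod 3 = 1" unfolding k(3) by simp
  have "attainable k (k+3) (if k mod 3 = 1 then 3 else 4)"
    by (intro attainable_antitranspose[of "k+3"] attainable_extend attainable_even_square k)
  from extend[OF this] show ?thesis unfolding m unfolding k(3) by blast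
qed

text \<open>The last extension starts from two even sides: \<open>n\<close> by \<open>n-2\<close>
  for even \<open>n\<close>, \<open>n-3\<close> by \<open>n+1\<close> for odd \<open>n\<close>.
  These shapes grow by multiples of 6 from 4 by 8, 6 by 4 and 8 by 6; \<open>n\<close> up to 5 is
  too small for this.\<close>

lemma rectangle_attained:
  assumes n: "n \<ge> 3"
  shows "\<exists>H. valid n (n+1) H \<and> defect n (n+1) H = (if n mod 3 = 2 then 5 else 3)"
proof -
  note e48 = attainable_extend_6_6[OF attainable_4_8]
    and e64 = attainable_extend_6_6[OF attainable_antitranspose[OF attainable_4_6]]
    and e86 = attainable_extend_6_6[OF attainable_antitranspose[OF attainable_6_8]]
  have "n = 3 \<or> n = 4 \<or> n = 5 \<or> (even n \<and> n - 2 \<ge> 4) \<or> (even (n - 3) \<and> n - 3 \<ge> 4)"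
    using n by presburger
  then consider "n = 3" | "n = 4" | "n = 5" | "even n" "n - 2 \<ge> 4" | "even (n - 3)" "n - 3 \<ge> 4"
    by blast
  thus ?thesis
  proof cases
    case 1
    have "valid 3 4 {(1,2)}" by (rule valid_shallow) auto
    thus ?thesis unfolding 1 by (auto intro!: exI[of _ "{(1,2)}"] simp: defect_def)
  next
    case 2
    have "valid 4 5 {(1,1),(2,2),(1,3)}" by (rule valid_shallow) auto
    thus ?thesis unfolding 2 by (auto intro!: exI[of _ "{(1,1),(2,2),(1,3)}"] simp: defect_def)
  next
    case 3
    obtain H where H: "valid 6 5 H" "defect 6 5 H = 5" using extend[OF attainable_3_5] by auto
    define K where "K = (\<lambda>(i,j). (5-1-j,6-1-i)) ` H"
    have "card K = card H" unfolding K_def by (rule card_image) (auto simp: inj_on_def)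
    hence "defect 5 6 K = 5" using H(2) by (simp add: defect_def)
    moreover have "valid 5 6 K" unfolding K_def by (rule valid_antitranspose[OF H(1)]) auto
    ultimately show ?thesis unfolding 3 by auto
  next
    case 4
    hence "even (n-2)" by simp
    hence "attainable n (n-2) (if n mod 3 = 2 then 5 else 3)" using 4(2)
    proof (cases rule: even_cases_mod_6)
      case (1 k)
      hence n: "n = 6 + 6 * int k" by simp
      have "n mod 3 \<noteq> 2" unfolding n by presburger
      thus ?thesis using e64[of k k] n by simp
    next
      case (2 k)
      hence n: "n = 8 + 6 * int k" by simp
      have "n mod 3 = 2" unfolding n by presburger
      thus ?thesis using e86[of k k] n by simp
    next
      case (3 k)
      hence n: "n = 10 + 6 * int k" by simp
      have "n mod 3 \<noteq> 2" unfolding n by presburger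
      thus ?thesis using e48[of "Suc k" k] n by (simp add: algebra_simps)
    qed
    hence "attainable n (n-2+3) (if n mod 3 = 2 then 5 else 3)"
      using 4 by (intro attainable_antitranspose[of "n-2+3"] attainable_extend attainable_antitranspose[of n])
    moreover have "n-2+3 = n+1" by simp
    ultimately show ?thesis unfolding attainable_def by metis
  next
    case 5
    hence "attainable (n-3) (n+1) (if n mod 3 = 2 then 5 else 3)"
    proof (cases rule: even_cases_mod_6)
      case (1 k)
      hence n: "n = 7 + 6 * int k" by simp
      have "n mod 3 \<noteq> 2" unfolding n by presburger
      thus ?thesis using e48[of k k] n by (simp add: algebra_simps)
    next
      case (2 k)
      hence n: "n = 9 + 6 * int k" by simp
      have "n mod 3 \<noteq> 2" unfolding n by presburger
      thus ?thesis using e64[of k "Suc k"] n by (simp add: algebra_simps)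
    next
      case (3 k)
      hence n: "n = 11 + 6 * int k" by simp
      have "n mod 3 = 2" unfolding n by presburger
      thus ?thesis using e86[of k "Suc k"] n by (simp add: algebra_simps)
    qed
    moreover have "n-3+3 = n" by simp
    ultimately show ?thesis using extend by metis
  qed
qed

theorem theorem1:
  fixes N :: nat
  assumes "N \<ge> 3"
  shows "real (hmax N N) =
           (if N mod 3 = 1 then (real N - 1)^2 / 3 - 1
            else if (\<exists>l::nat. l \<ge> 1 \<and> N = 2^l + 1) then real N * (real N - 2) / 3
            else real N * (real N - 2) / 3 - 1)
       \<and> real (hmax N (N + 1)) =
           (if N mod 3 = 0 \<or> N mod 3 = 1 then real N * (real N - 1) / 3 - 1
            else (real N + 1) * (real N - 2) / 3 - 1)"
proof
  let ?n = "int N"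
  have n: "?n \<ge> 3" using assms by simp
  have N1: "N \<ge> 1" "N + 1 \<ge> 1" using assms by simp_all
  have mods: "?n mod 3 = 0 \<and> N mod 3 = 0 \<or> ?n mod 3 = 1 \<and> N mod 3 = 1 \<or> ?n mod 3 = 2 \<and> N mod 3 = 2"
    by presburger
  have sq: "(?n - 1) * (?n - 1) mod 3 = (if N mod 3 = 1 then 0 else 1)"
    using mods by (subst mod_mult_eq[symmetric], subst (1 2) mod_diff_left_eq[symmetric]) auto
  have re: "(?n - 1) * ?n mod 3 = (if N mod 3 = 2 then 2 else 0)"
    using mods by (subst mod_mult_eq[symmetric], subst (1) mod_diff_left_eq[symmetric]) auto
  have pos: "defect ?n ?n K > 0" if "valid ?n ?n K" for K using defect_pos[OF that] n by simp
  have one: "\<exists>l::nat. l \<ge> 1 \<and> N = 2^l + 1" if K: "valid ?n ?n K" "defect ?n ?n K = 1" for K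
  proof -
    obtain l :: nat where l: "?n = 2^l + 1" using defect_1_size[OF K(1) _ _ K(2)] n by auto
    hence "int N = int (2^l + 1)" by simp
    hence "N = 2^l + 1" by (simp only: of_nat_eq_iff)
    moreover from this have "l \<noteq> 0" using assms by (intro notI) simp
    ultimately show ?thesis by (intro exI[of _ l]) simp
  qed
  show "real (hmax N N) =
           (if N mod 3 = 1 then (real N - 1)^2 / 3 - 1
            else if (\<exists>l::nat. l \<ge> 1 \<and> N = 2^l + 1) then real N * (real N - 2) / 3
            else real N * (real N - 2) / 3 - 1)"
  proof (cases "N mod 3 \<noteq> 1 \<and> (\<exists>l::nat. l \<ge> 1 \<and> N = 2^l + 1)")
    case True
    then obtain l :: nat where l: "N = 2^l + 1" by blast
    hence nl: "?n = 2^l + 1" by simp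
    obtain H where H: "valid ?n ?n H" "defect ?n ?n H = 1" using exists_defect_1[of l] unfolding nl by blast
    have "real (hmax N N) = ((real N - 1) * (real N - 1) - real_of_int (defect ?n ?n H)) / 3"
      by (rule hmax_defect[OF N1(1) N1(1) H(1)]) (use pos H in force)
    thus ?thesis using True H(2) by (simp add: algebra_simps)
  next
    case False
    \<comment> \<open>The sizes omitted by \<open>square_attained\<close> are \<open>2^1 + 1\<close>
      and \<open>2^2 + 1\<close>, both in the case already treated.\<close>
    have "N \<noteq> 3" "N \<noteq> 5"
    proof -
      show "N \<noteq> 3" using False by (intro notI) (auto dest: spec[of _ 1])
      show "N \<noteq> 5" using False by (intro notI) (auto dest: spec[of _ 2])
    qed
    hence "?n \<noteq> 3" "?n \<noteq> 5" by simp_all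
    moreover have m1: "?n mod 3 = 1 \<longleftrightarrow> N mod 3 = 1" using mods by auto
    ultimately obtain H where H: "valid ?n ?n H" "defect ?n ?n H = (if N mod 3 = 1 then 3 else 4)"
      using square_attained[OF n] by auto
    have "defect ?n ?n H \<le> defect ?n ?n K" if K: "valid ?n ?n K" for K
    proof -
      have "defect ?n ?n K mod 3 = (if N mod 3 = 1 then 0 else 1)" unfolding defect_mod_3 sq ..
      moreover have "N mod 3 \<noteq> 1 \<Longrightarrow> defect ?n ?n K \<noteq> 1" using one[OF K] False by blast
      \<comment> \<open>A positive defect divisible by 3 is at least 3; one congruent to 1 is at
        least 4 once 1 is excluded.\<close>
      ultimately show ?thesis using pos[OF K] unfolding H(2) by (cases "N mod 3 = 1") (simp; presburger)+
    qed
    hence "real (hmax N N) = ((real N - 1) * (real N - 1) - real_of_int (defect ?n ?n H)) / 3"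
      by (intro hmax_defect[OF N1(1) N1(1) H(1)])
    thus ?thesis using False unfolding H(2) by (auto simp: field_simps power2_eq_square)
  qed
  obtain H where H: "valid ?n (?n+1) H" "defect ?n (?n+1) H = (if N mod 3 = 2 then 5 else 3)"
    using rectangle_attained[OF n] mods by auto
  have N1i: "int (N+1) = ?n + 1" by simp
  have "defect ?n (?n+1) H \<le> defect ?n (?n+1) K" if K: "valid ?n (?n+1) K" for K
  proof -
    have "defect ?n (?n+1) K mod 3 = (if N mod 3 = 2 then 2 else 0)" unfolding defect_mod_3 using re by simp
    moreover have "defect ?n (?n+1) K > 0" using defect_pos[OF K] n by simp
    \<comment> \<open>Residue 2 without the value 2 leaves at least 5; residue 0 and positivity
      leave at least 3.\<close>
    ultimately show ?thesis using defect_not_2[OF K n] unfolding H(2) by (cases "N mod 3 = 2") (simp; presburger)+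
  qed
  hence "real (hmax N (N+1)) = ((real N - 1) * (real (N+1) - 1) - real_of_int (defect ?n (int (N+1)) H)) / 3"
    using H(1) unfolding N1i[symmetric] by (intro hmax_defect[OF N1])
  hence h: "real (hmax N (N+1)) = ((real N - 1) * real N - (if N mod 3 = 2 then 5 else 3)) / 3"
    unfolding N1i H(2) by simp
  show "real (hmax N (N + 1)) =
           (if N mod 3 = 0 \<or> N mod 3 = 1 then real N * (real N - 1) / 3 - 1
            else (real N + 1) * (real N - 2) / 3 - 1)"
    using mods unfolding h by (auto simp: field_simps)
qed

end
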